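(* No model of $\mathrm{ZFU}_{\mathrm R}$ + Plenitude, equipped with its definable classes, has a parametrically definable map (from classes to objects) that fulfills Basic Law V.
   Context: The language of urelement set theory has $\in$ and a unary predicate $\mathscr{A}$ for urelements; a set is an object that is not a urelement. $\mathrm{ZFU}_{\mathrm R}$ has the axioms: urelements have no members; Extensionality for sets (sets with the same members are equal); Foundation; Pairing; Union; Powerset; Infinity; the Separation schema; the Replacement schema. The urelements may form a proper class. No form of the Axiom of Choice is assumed. Ordinals are transitive pure sets (sets with no urelements in their transitive closure) well-ordered by $\in$; a well-ordered cardinal is an initial ordinal. Plenitude is the axiom: for every well-ordered cardinal $\kappa$ there is a set of urelements of size $\kappa$ (i.e. in bijection with $\kappa$). Given a model $U$, its definable classes are the collections $\{x\in U: U\models\psi(x,z)\}$ with $\psi$ a first-order formula and $z\in U$ a parameter. "Equipped with definable classes" means that we consider the two-sorted structure whose objects are the elements of $U$ and whose classes are the definable classes. A map $X\mapsto\epsilon X$ from classes to objects is parametrically definable if its graph is defined over this structure by a second-order formula $\varphi(X,y,P)$ (quantifiers over objects and over definable classes allowed) with a definable class $P$ of $U$ as parameter. It fulfills Basic Law V if for all classes $X,Y$: $\epsilon X=\epsilon Y\leftrightarrow\forall x\,(x\in X\leftrightarrow x\in Y)$. *)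

theory Defs
  imports Main
begin

text \<open>
  A structure for urelement set theory is given by a type \<open>'u\<close> (its domain, the objects), a
  membership relation \<open>E\<close> and a predicate \<open>Ur\<close>. Variables of either sort are natural numbers,
  interpreted by valuations, so a formula together with a valuation is a formula with parameters.
\<close>

datatype fm =
    Mem nat nat
  | Urel nat
  | Eq nat nat
  | Neg fm
  | Conj fm fm
  | All nat fm

text \<open>
  Two-sorted formulas: \<open>InC i k\<close> says that object \<open>i\<close> belongs to class \<open>k\<close>,
  and \<open>EqC\<close> and \<open>AllC\<close> are equality of and quantification over classes.
\<close>

datatype fm2 =
    Mem2 nat nat
  | Urel2 nat
  | Eq2 nat nat
  | InC nat nat
  | EqC nat nat
  | Neg2 fm2
  | Conj2 fm2 fm2
  | All2 nat fm2
  | AllC nat fm2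

context
  fixes E :: "'u \<Rightarrow> 'u \<Rightarrow> bool" (infix "\<^bold>\<in>" 50)
    and Ur :: "'u \<Rightarrow> bool"
begin

primrec sat :: "(nat \<Rightarrow> 'u) \<Rightarrow> fm \<Rightarrow> bool" where
  "sat v (Mem i j) \<longleftrightarrow> v i \<^bold>\<in> v j"
| "sat v (Urel i) \<longleftrightarrow> Ur (v i)"
| "sat v (Eq i j) \<longleftrightarrow> v i = v j"
| "sat v (Neg \<phi>) \<longleftrightarrow> \<not> sat v \<phi>"
| "sat v (Conj \<phi> \<psi>) \<longleftrightarrow> sat v \<phi> \<and> sat v \<psi>"
| "sat v (All i \<phi>) \<longleftrightarrow> (\<forall>x. sat (v(i := x)) \<phi>)"

text \<open>Variable 0 ranges over the class; every other free variable denotes the parameter \<open>z\<close>.\<close>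

definition definable_class :: "'u set \<Rightarrow> bool" where
  "definable_class X \<longleftrightarrow> (\<exists>\<psi> z. X = {x. sat ((\<lambda>_. z)(0 := x)) \<psi>})"

primrec sat2 :: "(nat \<Rightarrow> 'u) \<Rightarrow> (nat \<Rightarrow> 'u set) \<Rightarrow> fm2 \<Rightarrow> bool" where
  "sat2 v V (Mem2 i j) \<longleftrightarrow> v i \<^bold>\<in> v j"
| "sat2 v V (Urel2 i) \<longleftrightarrow> Ur (v i)"
| "sat2 v V (Eq2 i j) \<longleftrightarrow> v i = v j"
| "sat2 v V (InC i k) \<longleftrightarrow> v i \<in> V k"
| "sat2 v V (EqC k l) \<longleftrightarrow> V k = V l"
| "sat2 v V (Neg2 \<phi>) \<longleftrightarrow> \<not> sat2 v V \<phi>"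
| "sat2 v V (Conj2 \<phi> \<psi>) \<longleftrightarrow> sat2 v V \<phi> \<and> sat2 v V \<psi>"
| "sat2 v V (All2 i \<phi>) \<longleftrightarrow> (\<forall>x. sat2 (v(i := x)) V \<phi>)"
| "sat2 v V (AllC k \<phi>) \<longleftrightarrow> (\<forall>X. definable_class X \<longrightarrow> sat2 v (V(k := X)) \<phi>)"

text \<open>
  A map from classes to objects is represented by a total function on \<open>'u set\<close> whose values
  outside the definable classes are irrelevant. In the defining formula, class variable 0 denotes
  the argument, every other free class variable the parameter, and free object variables the value.
\<close>

definition param_definable_map :: "('u set \<Rightarrow> 'u) \<Rightarrow> bool" where
  "param_definable_map ext \<longleftrightarrow>
     (\<exists>\<phi> P. definable_class P \<and>
        (\<forall>X y. definable_class X \<longrightarrow>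
           (ext X = y \<longleftrightarrow> sat2 (\<lambda>_. y) ((\<lambda>_. P)(0 := X)) \<phi>)))"

definition basic_law_V :: "('u set \<Rightarrow> 'u) \<Rightarrow> bool" where
  "basic_law_V ext \<longleftrightarrow>
     (\<forall>X Y. definable_class X \<longrightarrow> definable_class Y \<longrightarrow>
        (ext X = ext Y \<longleftrightarrow> (\<forall>x. x \<in> X \<longleftrightarrow> x \<in> Y)))"

definition is_set :: "'u \<Rightarrow> bool" where
  "is_set x \<longleftrightarrow> \<not> Ur x"

definition subset_of :: "'u \<Rightarrow> 'u \<Rightarrow> bool" where
  "subset_of x y \<longleftrightarrow> is_set x \<and> is_set y \<and> (\<forall>z. z \<^bold>\<in> x \<longrightarrow> z \<^bold>\<in> y)"

definition urelements_empty :: bool where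
  "urelements_empty \<longleftrightarrow> (\<forall>a x. Ur a \<longrightarrow> \<not> x \<^bold>\<in> a)"

definition extensionality :: bool where
  "extensionality \<longleftrightarrow>
     (\<forall>x y. is_set x \<longrightarrow> is_set y \<longrightarrow> (\<forall>z. z \<^bold>\<in> x \<longleftrightarrow> z \<^bold>\<in> y) \<longrightarrow> x = y)"

definition foundation :: bool where
  "foundation \<longleftrightarrow>
     (\<forall>x. is_set x \<longrightarrow> (\<exists>y. y \<^bold>\<in> x) \<longrightarrow> (\<exists>y. y \<^bold>\<in> x \<and> (\<forall>z. z \<^bold>\<in> x \<longrightarrow> \<not> z \<^bold>\<in> y)))"

definition pairing :: bool where
  "pairing \<longleftrightarrow> (\<forall>x y. \<exists>p. is_set p \<and> (\<forall>z. z \<^bold>\<in> p \<longleftrightarrow> z = x \<or> z = y))"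

definition union_axiom :: bool where
  "union_axiom \<longleftrightarrow>
     (\<forall>x. is_set x \<longrightarrow> (\<exists>u. is_set u \<and> (\<forall>z. z \<^bold>\<in> u \<longleftrightarrow> (\<exists>y. y \<^bold>\<in> x \<and> z \<^bold>\<in> y))))"

definition powerset :: bool where
  "powerset \<longleftrightarrow> (\<forall>x. is_set x \<longrightarrow> (\<exists>p. is_set p \<and> (\<forall>z. z \<^bold>\<in> p \<longleftrightarrow> subset_of z x)))"

definition infinity :: bool where
  "infinity \<longleftrightarrow>
     (\<exists>w. is_set w \<and>
        (\<exists>e. e \<^bold>\<in> w \<and> is_set e \<and> (\<forall>z. \<not> z \<^bold>\<in> e)) \<and>
        (\<forall>y. y \<^bold>\<in> w \<longrightarrow> (\<exists>s. s \<^bold>\<in> w \<and> is_set s \<and> (\<forall>z. z \<^bold>\<in> s \<longleftrightarrow> z \<^bold>\<in> y \<or> z = y))))"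

definition separation :: bool where
  "separation \<longleftrightarrow>
     (\<forall>\<phi> v i x. is_set x \<longrightarrow>
        (\<exists>y. is_set y \<and> (\<forall>z. z \<^bold>\<in> y \<longleftrightarrow> z \<^bold>\<in> x \<and> sat (v(i := z)) \<phi>)))"

definition replacement :: bool where
  "replacement \<longleftrightarrow>
     (\<forall>\<phi> v i j x. i \<noteq> j \<longrightarrow> is_set x \<longrightarrow>
        (\<forall>a. a \<^bold>\<in> x \<longrightarrow> (\<exists>!b. sat (v(i := a, j := b)) \<phi>)) \<longrightarrow>
        (\<exists>y. is_set y \<and> (\<forall>b. b \<^bold>\<in> y \<longleftrightarrow> (\<exists>a. a \<^bold>\<in> x \<and> sat (v(i := a, j := b)) \<phi>))))"

definition ZFU_R :: bool where
  "ZFU_R \<longleftrightarrow>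
     urelements_empty \<and> extensionality \<and> foundation \<and> pairing \<and> union_axiom \<and> powerset \<and>
     infinity \<and> separation \<and> replacement"

definition transitive_set :: "'u \<Rightarrow> bool" where
  "transitive_set x \<longleftrightarrow> is_set x \<and> (\<forall>y z. y \<^bold>\<in> x \<longrightarrow> z \<^bold>\<in> y \<longrightarrow> z \<^bold>\<in> x)"

definition in_trans_closure :: "'u \<Rightarrow> 'u \<Rightarrow> bool" where
  "in_trans_closure y x \<longleftrightarrow> (\<forall>t. transitive_set t \<longrightarrow> subset_of x t \<longrightarrow> y \<^bold>\<in> t)"

definition pure_set :: "'u \<Rightarrow> bool" where
  "pure_set x \<longleftrightarrow> is_set x \<and> (\<forall>y. in_trans_closure y x \<longrightarrow> \<not> Ur y)"

definition wellordered_by_mem :: "'u \<Rightarrow> bool" where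
  "wellordered_by_mem x \<longleftrightarrow>
     (\<forall>a. a \<^bold>\<in> x \<longrightarrow> \<not> a \<^bold>\<in> a) \<and>
     (\<forall>a b c. a \<^bold>\<in> x \<longrightarrow> b \<^bold>\<in> x \<longrightarrow> c \<^bold>\<in> x \<longrightarrow> a \<^bold>\<in> b \<longrightarrow> b \<^bold>\<in> c \<longrightarrow> a \<^bold>\<in> c) \<and>
     (\<forall>a b. a \<^bold>\<in> x \<longrightarrow> b \<^bold>\<in> x \<longrightarrow> a \<^bold>\<in> b \<or> a = b \<or> b \<^bold>\<in> a) \<and>
     (\<forall>s. subset_of s x \<longrightarrow> (\<exists>a. a \<^bold>\<in> s) \<longrightarrow>
        (\<exists>m. m \<^bold>\<in> s \<and> (\<forall>a. a \<^bold>\<in> s \<longrightarrow> a = m \<or> m \<^bold>\<in> a)))"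

definition ordinal :: "'u \<Rightarrow> bool" where
  "ordinal x \<longleftrightarrow> transitive_set x \<and> pure_set x \<and> wellordered_by_mem x"

definition is_upair :: "'u \<Rightarrow> 'u \<Rightarrow> 'u \<Rightarrow> bool" where
  "is_upair p x y \<longleftrightarrow> is_set p \<and> (\<forall>z. z \<^bold>\<in> p \<longleftrightarrow> z = x \<or> z = y)"

text \<open>\<open>p\<close> is the Kuratowski pair of \<open>x\<close> and \<open>y\<close>.\<close>

definition is_opair :: "'u \<Rightarrow> 'u \<Rightarrow> 'u \<Rightarrow> bool" where
  "is_opair p x y \<longleftrightarrow> is_set p \<and> (\<forall>z. z \<^bold>\<in> p \<longleftrightarrow> is_upair z x x \<or> is_upair z x y)"

definition is_bijection :: "'u \<Rightarrow> 'u \<Rightarrow> 'u \<Rightarrow> bool" where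
  "is_bijection f x y \<longleftrightarrow>
     is_set f \<and>
     (\<forall>p. p \<^bold>\<in> f \<longrightarrow> (\<exists>a b. a \<^bold>\<in> x \<and> b \<^bold>\<in> y \<and> is_opair p a b)) \<and>
     (\<forall>a. a \<^bold>\<in> x \<longrightarrow> (\<exists>!b. b \<^bold>\<in> y \<and> (\<exists>p. p \<^bold>\<in> f \<and> is_opair p a b))) \<and>
     (\<forall>b. b \<^bold>\<in> y \<longrightarrow> (\<exists>!a. a \<^bold>\<in> x \<and> (\<exists>p. p \<^bold>\<in> f \<and> is_opair p a b)))"

definition equinumerous :: "'u \<Rightarrow> 'u \<Rightarrow> bool" where
  "equinumerous x y \<longleftrightarrow> (\<exists>f. is_bijection f x y)"

definition wo_cardinal :: "'u \<Rightarrow> bool" where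
  "wo_cardinal k \<longleftrightarrow> ordinal k \<and> (\<forall>b. b \<^bold>\<in> k \<longrightarrow> \<not> equinumerous b k)"

definition plenitude :: bool where
  "plenitude \<longleftrightarrow>
     (\<forall>k. wo_cardinal k \<longrightarrow> (\<exists>x. is_set x \<and> (\<forall>a. a \<^bold>\<in> x \<longrightarrow> Ur a) \<and> equinumerous x k))"

end

end

theory Submission
  imports Defs
begin

text \<open>
  A definable involution of the urelements extends, by \<open>\<in>\<close>-recursion, to an automorphism \<open>s\<close> of the
  model. Automorphisms permute the definable classes, so if \<open>s\<close> fixes the urelements \<open>A\<close> in the
  transitive closure of the parameter, then \<open>ext (s X) = s (ext X)\<close> for every definable class \<open>X\<close>.

  By Plenitude and a Hartogs argument there are sequences \<open>p\<close>, \<open>q\<close> of urelements, indexed by \<open>\<omega>\<close> and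
  disjoint from \<open>A\<close> and from each other. Let \<open>X\<close> be the class of all \<open>y\<close> that contain \<open>p m\<close> for all
  but finitely many \<open>m\<close>. Transpositions of urelements preserve \<open>X\<close>; those outside \<open>A\<close> hence fix
  \<open>ext X\<close>, so all urelements in the transitive closure of \<open>ext X\<close> lie in \<open>A\<close>. Then the automorphism
  exchanging \<open>p\<close> and \<open>q\<close>, which fixes \<open>A\<close>, fixes \<open>ext X\<close> too, although it moves \<open>X\<close>: this
  contradicts Basic Law V.
\<close>

section \<open>First-order definability with parameters\<close>

text \<open>\<open>E\<close> is an arbitrary relation satisfying the axioms: from outside it may be
  ill-founded, and its natural numbers may be nonstandard. Induction, recursion, finiteness and
  cardinality are therefore taken in the sense of the model, and every predicate or function fed to
  Separation or Replacement needs a proof that it is first-order definable with parameters. The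
  calculus of \<open>dfn\<close> and \<open>dterm\<close> supplies these proofs. The class X meets
  two opposing demands: its code must not remember any urelement outside A, yet some automorphism
  fixing A must move X. Ignoring finitely many exceptions achieves both, since a transposition
  disturbs at most two terms of a sequence, while the exchange of p and q disturbs all of them.
  Sequences rather than mere infinite sets are used because the common index matches the terms of p
  with those of q. Plenitude alone does not say that its urelements lie outside A, and A need not be
  well-orderable. A cardinal that does not inject into the union of A and omega forces infinitely
  many of them outside A without any choice.\<close>

lemma sat_cong_bounded:
  "\<exists>N. \<forall>v w. (\<forall>n<N. v n = w n) \<longrightarrow> sat E Ur v \<phi> = sat E Ur w \<phi>"
proof (induction \<phi>)
  case (Mem i j)
  show ?case by (rule exI[of _ "Suc (i + j)"]) auto
next
  case (Urel i)
  show ?case by (rule exI[of _ "Suc i"]) auto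
next
  case (Eq i j)
  show ?case by (rule exI[of _ "Suc (i + j)"]) auto
next
  case (Neg \<phi>)
  then show ?case by simp
next
  case (Conj \<phi> \<psi>)
  then obtain M N where
    M: "\<And>v w. (\<forall>n<M. v n = w n) \<Longrightarrow> sat E Ur v \<phi> = sat E Ur w \<phi>" and
    N: "\<And>v w. (\<forall>n<N. v n = w n) \<Longrightarrow> sat E Ur v \<psi> = sat E Ur w \<psi>" by blast
  have "sat E Ur v (Conj \<phi> \<psi>) = sat E Ur w (Conj \<phi> \<psi>)" if "\<forall>n<max M N. v n = w n" for v w
    using M[of v w] N[of v w] that by simp
  then show ?case by blast
next
  case (All i \<phi>)
  then obtain N where N: "\<And>v w. (\<forall>n<N. v n = w n) \<Longrightarrow> sat E Ur v \<phi> = sat E Ur w \<phi>" by blast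
  have *: "sat E Ur (v(i := x)) \<phi> = sat E Ur (w(i := x)) \<phi>" if "\<forall>n<N. v n = w n" for v w x
    by (rule N) (use that in auto)
  then have "(\<forall>x. sat E Ur (v(i := x)) \<phi>) = (\<forall>x. sat E Ur (w(i := x)) \<phi>)"
    if "\<forall>n<N. v n = w n" for v w by (simp only: *[OF that])
  then show ?case by (intro exI[of _ N]) simp
qed

text \<open>Since \<open>\<sigma>\<close> is arbitrary, a bound variable could capture renamed ones.
  It is replaced by an index \<open>k\<close> above all values of \<open>\<sigma>\<close> on the
  variables that matter; the sum is just a convenient bound for these values.\<close>

lemma sat_rename: "\<exists>\<phi>'. \<forall>v. sat E Ur v \<phi>' = sat E Ur (\<lambda>n. v (\<sigma> n)) \<phi>"
proof (induction \<phi> arbitrary: \<sigma>)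
  case (Mem i j)
  show ?case by (rule exI[of _ "Mem (\<sigma> i) (\<sigma> j)"]) simp
next
  case (Urel i)
  show ?case by (rule exI[of _ "Urel (\<sigma> i)"]) simp
next
  case (Eq i j)
  show ?case by (rule exI[of _ "Eq (\<sigma> i) (\<sigma> j)"]) simp
next
  case (Neg \<phi>)
  obtain \<phi>' where "\<forall>v. sat E Ur v \<phi>' = sat E Ur (\<lambda>n. v (\<sigma> n)) \<phi>"
    using Neg.IH[of \<sigma>] by blast
  then show ?case by (intro exI[of _ "Neg \<phi>'"]) simp
next
  case (Conj \<phi> \<psi>)
  obtain \<phi>' \<psi>' where "\<forall>v. sat E Ur v \<phi>' = sat E Ur (\<lambda>n. v (\<sigma> n)) \<phi>"
    "\<forall>v. sat E Ur v \<psi>' = sat E Ur (\<lambda>n. v (\<sigma> n)) \<psi>"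
    using Conj.IH(1)[of \<sigma>] Conj.IH(2)[of \<sigma>] by blast
  then show ?case by (intro exI[of _ "Conj \<phi>' \<psi>'"]) simp
next
  case (All i \<phi>)
  obtain N where N: "\<And>v w. (\<forall>n<N. v n = w n) \<Longrightarrow> sat E Ur v \<phi> = sat E Ur w \<phi>"
    using sat_cong_bounded by blast
  define k where "k = Suc (\<Sum>n<N. \<sigma> n)"
  have k: "\<sigma> n \<noteq> k" if "n < N" for n
    using member_le_sum[of n "{..<N}" \<sigma>] that unfolding k_def by simp
  obtain \<phi>' where \<phi>': "\<And>v. sat E Ur v \<phi>' = sat E Ur (\<lambda>n. v ((\<sigma>(i := k)) n)) \<phi>"
    using All.IH[of "\<sigma>(i := k)"] by blast
  have "sat E Ur (v(k := x)) \<phi>' = sat E Ur ((\<lambda>n. v (\<sigma> n))(i := x)) \<phi>" for v x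
    unfolding \<phi>' by (rule N) (use k in auto)
  then show ?case by (intro exI[of _ "All k \<phi>'"]) simp
qed

named_theorems dfn_intros

text \<open>Predicates of valuations, taken up to equivalence with some formula, keep concrete
  syntax out of the later definability proofs.\<close>

definition fo :: "('u \<Rightarrow> 'u \<Rightarrow> bool) \<Rightarrow> ('u \<Rightarrow> bool) \<Rightarrow> ((nat \<Rightarrow> 'u) \<Rightarrow> bool) \<Rightarrow> bool" where
  "fo E Ur R \<longleftrightarrow> (\<exists>\<phi>. \<forall>v. sat E Ur v \<phi> = R v)"

lemma fo_neg: "fo E Ur R \<Longrightarrow> fo E Ur (\<lambda>v. \<not> R v)"
proof -
  assume "fo E Ur R"
  then obtain \<phi> where "\<forall>v. sat E Ur v \<phi> = R v" unfolding fo_def by (elim exE)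
  then show ?thesis unfolding fo_def by (intro exI[of _ "Neg \<phi>"]) simp
qed

lemma fo_conj: "fo E Ur R \<Longrightarrow> fo E Ur S \<Longrightarrow> fo E Ur (\<lambda>v. R v \<and> S v)"
proof -
  assume "fo E Ur R" "fo E Ur S"
  then obtain \<phi> \<psi> where "\<forall>v. sat E Ur v \<phi> = R v" "\<forall>v. sat E Ur v \<psi> = S v"
    unfolding fo_def by (elim exE)
  then show ?thesis unfolding fo_def by (intro exI[of _ "Conj \<phi> \<psi>"]) simp
qed

lemma fo_rename: "fo E Ur R \<Longrightarrow> fo E Ur (\<lambda>v. R (\<lambda>n. v (\<sigma> n)))"
proof -
  assume "fo E Ur R"
  then obtain \<phi> where \<phi>: "\<And>v. sat E Ur v \<phi> = R v" unfolding fo_def by blast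
  obtain \<phi>' where "\<forall>v. sat E Ur v \<phi>' = sat E Ur (\<lambda>n. v (\<sigma> n)) \<phi>"
    using sat_rename[of E Ur \<sigma> \<phi>] by (elim exE)
  then show ?thesis unfolding fo_def \<phi> by (rule exI)
qed

text \<open>In the predicate the bound variable sits at place 0 and the others are shifted up.
  \<open>case_nat N id\<close> sends 0 to \<open>N\<close> and undoes the shift; as
  \<open>\<phi>\<close> depends only on places below \<open>N\<close>, its other variables land
  below \<open>N\<close> and are not captured.\<close>

lemma fo_all:
  assumes "fo E Ur R"
  shows "fo E Ur (\<lambda>v. \<forall>x. R (case_nat x v))"
proof -
  obtain \<phi> where \<phi>: "\<forall>v. sat E Ur v \<phi> = R v" using assms unfolding fo_def by (elim exE)
  obtain N where N: "\<forall>v w. (\<forall>n<N. v n = w n) \<longrightarrow> sat E Ur v \<phi> = sat E Ur w \<phi>"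
    using sat_cong_bounded[of E Ur \<phi>] by (elim exE)
  obtain \<phi>' where \<phi>': "\<forall>v. sat E Ur v \<phi>' = sat E Ur (\<lambda>n. v (case_nat N id n)) \<phi>"
    using sat_rename[of E Ur "case_nat N id" \<phi>] by (elim exE)
  have "sat E Ur (v(N := x)) \<phi>' = R (case_nat x v)" for v x
  proof -
    have "sat E Ur (\<lambda>n. (v(N := x)) (case_nat N id n)) \<phi> = sat E Ur (case_nat x v) \<phi>"
      by (rule N[rule_format]) (auto split: nat.split)
    then show ?thesis using \<phi> \<phi>' by simp
  qed
  then show ?thesis unfolding fo_def by (intro exI[of _ "All N \<phi>'"]) simp
qed

text \<open>Interleaving leaves infinitely many places for variables and infinitely many for
  parameters, so the number of parameters never has to be tracked.\<close>

definition merge :: "(nat \<Rightarrow> 'u) \<Rightarrow> (nat \<Rightarrow> 'u) \<Rightarrow> nat \<Rightarrow> 'u" where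
  "merge c w n = (if even n then w (n div 2) else c (n div 2))"

text \<open>The odd places of the valuation hold the parameters.\<close>

definition dfn :: "('u \<Rightarrow> 'u \<Rightarrow> bool) \<Rightarrow> ('u \<Rightarrow> bool) \<Rightarrow> ((nat \<Rightarrow> 'u) \<Rightarrow> bool) \<Rightarrow> bool" where
  "dfn E Ur R \<longleftrightarrow> (\<exists>R' c. fo E Ur R' \<and> R = (\<lambda>w. R' (merge c w)))"

lemma dfnI: "fo E Ur R' \<Longrightarrow> (\<And>w. R w = R' (merge c w)) \<Longrightarrow> dfn E Ur R"
  unfolding dfn_def by blast

lemma fo_imp_dfn: "fo E Ur R \<Longrightarrow> dfn E Ur R"
  by (rule dfnI[OF fo_rename[where \<sigma> = "\<lambda>n. 2 * n"]]) (auto simp: merge_def)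

lemma dfn_neg [dfn_intros]: "dfn E Ur R \<Longrightarrow> dfn E Ur (\<lambda>w. \<not> R w)"
proof -
  assume "dfn E Ur R"
  then obtain R' c where "fo E Ur R'" "R = (\<lambda>w. R' (merge c w))" unfolding dfn_def by (elim exE conjE)
  then show ?thesis by (intro dfnI[OF fo_neg]) auto
qed

lemma dfn_conj [dfn_intros]:
  assumes "dfn E Ur R" "dfn E Ur S"
  shows "dfn E Ur (\<lambda>w. R w \<and> S w)"
proof -
  obtain R' c S' d where R: "fo E Ur R'" "R = (\<lambda>w. R' (merge c w))"
    and S: "fo E Ur S'" "S = (\<lambda>w. S' (merge d w))"
    using assms unfolding dfn_def by (elim exE conjE)
  \<comment> \<open>In the joint parameter sequence \<open>merge d c\<close> the values of
    \<open>c\<close> take the even places and those of \<open>d\<close> the odd ones. Parameter k,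
    at place 2k+1 of either valuation, is thus found at place 4k+1 or 4k+3.\<close>
  define \<rho> where "\<rho> n = (if even n then n else 2 * (n - 1) + 1)" for n :: nat
  define \<tau> where "\<tau> n = (if even n then n else 2 * n + 1)" for n :: nat
  have *: "merge c w = (\<lambda>n. merge (merge d c) w (\<rho> n))" "merge d w = (\<lambda>n. merge (merge d c) w (\<tau> n))" for w
    by (auto simp: merge_def \<rho>_def \<tau>_def fun_eq_iff elim!: oddE)
  have "(R w \<and> S w) = (\<lambda>u. R' (\<lambda>n. u (\<rho> n)) \<and> S' (\<lambda>n. u (\<tau> n))) (merge (merge d c) w)" for w
    by (simp only: R(2) S(2) *[of w])
  then show ?thesis
    by (intro dfnI[OF fo_conj[OF fo_rename[OF R(1), of \<rho>] fo_rename[OF S(1), of \<tau>]]])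
qed

text \<open>The bound object becomes place 0 and the remaining variables move up. In this form
  higher-order unification can read off \<open>R\<close>, and \<open>intro dfn_intros\<close>
  follows the shape of a HOL predicate.\<close>

lemma dfn_all [dfn_intros]:
  assumes "dfn E Ur (\<lambda>w. R (w 0) (\<lambda>n. w (Suc n)))"
  shows "dfn E Ur (\<lambda>w. \<forall>x. R x w)"
proof -
  obtain R' c where R: "fo E Ur R'" "(\<lambda>w. R (w 0) (\<lambda>n. w (Suc n))) = (\<lambda>w. R' (merge c w))"
    using assms unfolding dfn_def by (elim exE conjE)
  define \<rho> where "\<rho> n = (if n = 0 then 0 else if even n then n - 1 else n + 1)" for n :: nat
  have *: "merge c (case_nat x w) = (\<lambda>n. case_nat x (merge c w) (\<rho> n))" for x w
  proof
    fix n
    show "merge c (case_nat x w) n = case_nat x (merge c w) (\<rho> n)"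
    proof (cases n)
      case (Suc m)
      then show ?thesis by (cases "even m") (auto simp: merge_def \<rho>_def elim!: evenE oddE)
    qed (simp add: merge_def \<rho>_def)
  qed
  have "R x w = R' (\<lambda>n. case_nat x (merge c w) (\<rho> n))" for x w
    using fun_cong[OF R(2), of "case_nat x w"] unfolding * by simp
  then show ?thesis
    by (intro dfnI[OF fo_all[OF fo_rename[OF R(1), of \<rho>]]]) simp
qed

lemma dfn_rename:
  assumes "dfn E Ur R"
  shows "dfn E Ur (\<lambda>w. R (\<lambda>n. w (\<sigma> n)))"
proof -
  obtain R' c where R: "fo E Ur R'" "R = (\<lambda>w. R' (merge c w))"
    using assms unfolding dfn_def by (elim exE conjE)
  define \<rho> where "\<rho> n = (if even n then 2 * \<sigma> (n div 2) else n)" for n :: nat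
  have *: "merge c (\<lambda>n. w (\<sigma> n)) = (\<lambda>n. merge c w (\<rho> n))" for w
    by (auto simp: merge_def \<rho>_def fun_eq_iff)
  show ?thesis
    by (rule dfnI[OF fo_rename[OF R(1)], where c = c]) (simp add: R(2) *)
qed

lemma dfn_disj [dfn_intros]: "dfn E Ur R \<Longrightarrow> dfn E Ur S \<Longrightarrow> dfn E Ur (\<lambda>w. R w \<or> S w)"
  using dfn_neg[of E Ur "\<lambda>w. \<not> R w \<and> \<not> S w"] by (simp add: dfn_conj dfn_neg)

lemma dfn_imp [dfn_intros]: "dfn E Ur R \<Longrightarrow> dfn E Ur S \<Longrightarrow> dfn E Ur (\<lambda>w. R w \<longrightarrow> S w)"
  unfolding imp_conv_disj by (intro dfn_disj dfn_neg)

lemma dfn_iff [dfn_intros]: "dfn E Ur R \<Longrightarrow> dfn E Ur S \<Longrightarrow> dfn E Ur (\<lambda>w. R w \<longleftrightarrow> S w)"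
  unfolding iff_conv_conj_imp by (intro dfn_conj dfn_imp)

lemma dfn_ex [dfn_intros]:
  assumes "dfn E Ur (\<lambda>w. R (w 0) (\<lambda>n. w (Suc n)))"
  shows "dfn E Ur (\<lambda>w. \<exists>x. R x w)"
  using dfn_neg[OF dfn_all[of E Ur "\<lambda>x w. \<not> R x w", OF dfn_neg[OF assms]]] by simp

text \<open>A function counts as definable through its graph. It can then be substituted into a
  predicate at the price of a quantifier over its value, as \<open>dfn_subst1'\<close> does.\<close>

definition dterm :: "('u \<Rightarrow> 'u \<Rightarrow> bool) \<Rightarrow> ('u \<Rightarrow> bool) \<Rightarrow> ((nat \<Rightarrow> 'u) \<Rightarrow> 'u) \<Rightarrow> bool" where
  "dterm E Ur t \<longleftrightarrow> dfn E Ur (\<lambda>w. w 0 = t (\<lambda>n. w (Suc n)))"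

lemma dfn_eq_var: "dfn E Ur (\<lambda>w. w i = w j)"
  by (rule fo_imp_dfn) (auto simp: fo_def intro: exI[of _ "Eq i j"])

lemma dterm_var [dfn_intros]: "dterm E Ur (\<lambda>w. w i)"
  unfolding dterm_def by (rule dfn_eq_var)

lemma dterm_const [dfn_intros]: "dterm E Ur (\<lambda>w. c)"
proof -
  have "fo E Ur (\<lambda>v. v 0 = v 1)" unfolding fo_def by (rule exI[of _ "Eq 0 1"]) simp
  then show ?thesis unfolding dterm_def
    by (rule dfnI[where c = "\<lambda>_. c"]) (simp add: merge_def)
qed

lemma dfn_subst1':
  assumes "dfn E Ur (\<lambda>w. R (w 0) (\<lambda>n. w (Suc n)))" "dterm E Ur t"
  shows "dfn E Ur (\<lambda>w. R (t w) w)"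
proof -
  have "dfn E Ur (\<lambda>w. \<exists>x. x = t w \<and> R x w)"
    by (intro dfn_ex dfn_conj assms(1)) (use assms(2) in \<open>simp add: dterm_def\<close>)
  then show ?thesis by simp
qed

lemma dterm_rename: "dterm E Ur t \<Longrightarrow> dterm E Ur (\<lambda>w. t (\<lambda>n. w (\<sigma> n)))"
  unfolding dterm_def
  using dfn_rename[of E Ur "\<lambda>w. w 0 = t (\<lambda>n. w (Suc n))" "case_nat 0 (\<lambda>n. Suc (\<sigma> n))"]
  by simp

lemma dfn_subst1:
  assumes "dfn E Ur (\<lambda>w. R (w 0))" "dterm E Ur t"
  shows "dfn E Ur (\<lambda>w. R (t w))"
  by (rule dfn_subst1'[of E Ur "\<lambda>x w. R x"]) (use assms in simp_all)

lemma dfn_subst2: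
  assumes "dfn E Ur (\<lambda>w. R (w 0) (w 1))" "dterm E Ur t" "dterm E Ur s"
  shows "dfn E Ur (\<lambda>w. R (t w) (s w))"
proof -
  have "dfn E Ur (\<lambda>w. R (w 0) (s (\<lambda>n. w (Suc n))))"
    by (rule dfn_subst1'[of E Ur "\<lambda>y w. R (w 0) y", OF _ dterm_rename[OF assms(3)]])
      (use dfn_rename[OF assms(1), of "\<lambda>n. if n = 0 then 1 else 0"] in simp)
  then show ?thesis by (rule dfn_subst1'[of E Ur "\<lambda>x w. R x (s w)", OF _ assms(2)])
qed

lemma dfn_subst3:
  assumes "dfn E Ur (\<lambda>w. R (w 0) (w 1) (w 2))" "dterm E Ur t" "dterm E Ur s" "dterm E Ur r"
  shows "dfn E Ur (\<lambda>w. R (t w) (s w) (r w))"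
proof -
  have "dfn E Ur (\<lambda>w. R (w 1) (w 2) (w 0))"
    using dfn_rename[OF assms(1), of "\<lambda>n. if n = 2 then 0 else Suc n"] by (simp add: numeral_2_eq_2)
  then have "dfn E Ur (\<lambda>w. R (w 0) (w 1) (r (\<lambda>n. w (Suc (Suc n)))))"
    using dfn_subst1'[of E Ur "\<lambda>y w. R (w 0) (w 1) y", OF _ dterm_rename[OF assms(4)]]
    by (simp add: numeral_2_eq_2)
  from dfn_rename[OF this, of "\<lambda>n. if n = 0 then 1 else if n = 1 then 0 else n"]
  have "dfn E Ur (\<lambda>w. R (w 1) (w 0) (r (\<lambda>n. w (Suc (Suc n)))))" by simp
  then have "dfn E Ur (\<lambda>w. R (w 0) (s (\<lambda>n. w (Suc n))) (r (\<lambda>n. w (Suc n))))"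
    using dfn_subst1'[of E Ur "\<lambda>y w. R (w 0) y (r (\<lambda>n. w (Suc n)))", OF _ dterm_rename[OF assms(3)]]
    by simp
  then show ?thesis by (rule dfn_subst1'[of E Ur "\<lambda>x w. R x (s w) (r w)", OF _ assms(2)])
qed

lemma dfn_eq [dfn_intros]: "dterm E Ur t \<Longrightarrow> dterm E Ur s \<Longrightarrow> dfn E Ur (\<lambda>w. t w = s w)"
  by (rule dfn_subst2[where R = "(=)" and t = t and s = s]) (rule dfn_eq_var)

lemma dfn_mem [dfn_intros]: "dterm E Ur t \<Longrightarrow> dterm E Ur s \<Longrightarrow> dfn E Ur (\<lambda>w. E (t w) (s w))"
  by (rule dfn_subst2[where R = E and t = t and s = s], rule fo_imp_dfn) (auto simp: fo_def intro: exI[of _ "Mem 0 1"])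

lemma dfn_Ur [dfn_intros]: "dterm E Ur t \<Longrightarrow> dfn E Ur (\<lambda>w. Ur (t w))"
  by (rule dfn_subst1[where R = Ur and t = t], rule fo_imp_dfn) (auto simp: fo_def intro: exI[of _ "Urel 0"])

lemma dterm_subst1:
  assumes "dterm E Ur (\<lambda>w. f (w 0))" "dterm E Ur t"
  shows "dterm E Ur (\<lambda>w. f (t w))"
  unfolding dterm_def
  by (rule dfn_subst2[of E Ur "\<lambda>y x. y = f x"])
    (use assms(1) in \<open>simp add: dterm_def\<close>, rule dterm_var, rule dterm_rename[OF assms(2)])

lemma dterm_subst2:
  assumes "dterm E Ur (\<lambda>w. f (w 0) (w 1))" "dterm E Ur t" "dterm E Ur s"
  shows "dterm E Ur (\<lambda>w. f (t w) (s w))"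
  unfolding dterm_def
  by (rule dfn_subst3[of E Ur "\<lambda>y x z. y = f x z"])
    (use assms(1) in \<open>simp add: dterm_def numeral_2_eq_2\<close>, rule dterm_var,
      (rule dterm_rename, fact)+)

text \<open>Unlike for \<open>THE\<close>, the value in the absence of a unique witness does not depend on the predicate,
  which keeps the graph definable.\<close>

definition the1 :: "('u \<Rightarrow> bool) \<Rightarrow> 'u" where
  "the1 P = (if \<exists>!x. P x then THE x. P x else undefined)"

lemma the1_eq:
  assumes "P a" "\<And>x. P x \<Longrightarrow> x = a"
  shows "the1 P = a"
proof -
  have "\<exists>!x. P x" using assms by blast
  moreover have "(THE x. P x) = a" using assms by (rule the_equality)
  ultimately show ?thesis by (simp add: the1_def)
qed

lemma the1I:
  assumes "\<exists>!x. P x"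
  shows "P (the1 P)"
  using theI'[OF assms] assms by (simp add: the1_def)

lemma dterm_the1 [dfn_intros]:
  assumes "dfn E Ur (\<lambda>w. P (w 0) (\<lambda>n. w (Suc n)))"
  shows "dterm E Ur (\<lambda>w. the1 (\<lambda>x. P x w))"
proof -
  have "(y = the1 Q) \<longleftrightarrow> (Q y \<and> (\<forall>x. Q x \<longrightarrow> x = y)) \<or>
      (\<not> (\<exists>x. Q x \<and> (\<forall>z. Q z \<longrightarrow> z = x)) \<and> y = undefined)" for y and Q :: "'a \<Rightarrow> bool"
  proof (cases "\<exists>!x. Q x")
    case True
    then obtain a where a: "Q a" "\<And>x. Q x \<Longrightarrow> x = a" by blast
    have "Q = (\<lambda>x. x = a)" by (intro ext iffI) (fact a(2), simp add: a(1))
    moreover have "the1 Q = a" using a by (rule the1_eq)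
    ultimately show ?thesis by auto
  next
    case False
    then have "the1 Q = undefined" by (simp only: the1_def if_False)
    with False show ?thesis by metis
  qed
  moreover have P: "dfn E Ur (\<lambda>w. P (w (f 0)) (\<lambda>n. w (f (Suc n))))" for f
    using dfn_rename[OF assms, of f] by simp
  ultimately show ?thesis
    unfolding dterm_def
    by (simp only:)
      (intro dfn_disj dfn_conj dfn_all dfn_imp dfn_eq dterm_var dterm_const dfn_neg dfn_ex
        P[of id, simplified id_def] P[of "case_nat 0 (\<lambda>n. Suc (Suc n))", simplified]
        P[of "case_nat 0 (\<lambda>n. Suc (Suc (Suc n)))", simplified])
qed

lemma dterm_if [dfn_intros]:
  assumes "dfn E Ur P" "dterm E Ur t" "dterm E Ur s"
  shows "dterm E Ur (\<lambda>w. if P w then t w else s w)"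
proof -
  have "(y = (if Q then a else b)) \<longleftrightarrow> Q \<and> y = a \<or> \<not> Q \<and> y = b" for y a b :: 'a and Q
    by simp
  then show ?thesis
    unfolding dterm_def
    by (simp only:)
      (intro dfn_disj dfn_conj dfn_eq dterm_var dfn_neg dfn_rename[OF assms(1)]
        dterm_rename[OF assms(2)] dterm_rename[OF assms(3)])
qed

section \<open>Sets of the model\<close>

locale zfu =
  fixes E :: "'u \<Rightarrow> 'u \<Rightarrow> bool" and Ur :: "'u \<Rightarrow> bool"
  assumes zfu: "ZFU_R E Ur"
begin

definition el :: "'u \<Rightarrow> 'u set" where
  "el y = {x. E x y}"

definition coded :: "'u set \<Rightarrow> bool" where
  "coded S \<longleftrightarrow> (\<exists>y. \<not> Ur y \<and> el y = S)"

text \<open>Urelements have the same extension as the empty set, so the clause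
  \<open>\<not> Ur y\<close> is needed for uniqueness.\<close>

definition mk :: "'u set \<Rightarrow> 'u" where
  "mk S = the1 (\<lambda>y. \<not> Ur y \<and> (\<forall>x. E x y \<longleftrightarrow> x \<in> S))"

abbreviation "dfnU \<equiv> dfn E Ur"
abbreviation "dtermU \<equiv> dterm E Ur"

lemma dfn_el [dfn_intros]: "dtermU t \<Longrightarrow> dtermU s \<Longrightarrow> dfnU (\<lambda>w. t w \<in> el (s w))"
  unfolding el_def mem_Collect_eq by (rule dfn_mem)

lemma dfn_ball_el [dfn_intros]:
  assumes "dtermU t" "dfnU (\<lambda>w. P (w 0) (\<lambda>n. w (Suc n)))"
  shows "dfnU (\<lambda>w. \<forall>x\<in>el (t w). P x w)"
  unfolding Ball_def by (intro dfn_intros dterm_rename[OF assms(1)] assms(2))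

lemma dfn_bex_el [dfn_intros]:
  assumes "dtermU t" "dfnU (\<lambda>w. P (w 0) (\<lambda>n. w (Suc n)))"
  shows "dfnU (\<lambda>w. \<exists>x\<in>el (t w). P x w)"
  unfolding Bex_def by (intro dfn_intros dterm_rename[OF assms(1)] assms(2))

lemma dterm_mk [dfn_intros]:
  assumes "dfnU (\<lambda>w. P (w 0) (\<lambda>n. w (Suc n)))"
  shows "dtermU (\<lambda>w. mk {x. P x w})"
  unfolding mk_def mem_Collect_eq
  by (intro dfn_intros)
    (use dfn_rename[OF assms, of "case_nat 0 (\<lambda>n. Suc (Suc n))"] in simp)

lemma el_ext: "\<not> Ur x \<Longrightarrow> \<not> Ur y \<Longrightarrow> el x = el y \<Longrightarrow> x = y"
  using zfu unfolding ZFU_R_def extensionality_def is_set_def el_def by blast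

lemma el_Ur: "Ur a \<Longrightarrow> el a = {}"
  using zfu unfolding ZFU_R_def urelements_empty_def el_def by blast

lemma
  assumes "coded S"
  shows not_Ur_mk: "\<not> Ur (mk S)" and el_mk: "el (mk S) = S"
proof -
  obtain y where y: "\<not> Ur y" "el y = S" using assms unfolding coded_def by blast
  have eq: "(\<lambda>z. \<not> Ur z \<and> (\<forall>x. E x z \<longleftrightarrow> x \<in> S)) = (\<lambda>z. \<not> Ur z \<and> el z = S)"
    by (auto simp: el_def fun_eq_iff)
  have "mk S = y"
    unfolding mk_def eq by (rule the1_eq) (use y el_ext in auto)
  then show "\<not> Ur (mk S)" "el (mk S) = S" using y by auto
qed

lemma mk_inject: "coded S \<Longrightarrow> coded T \<Longrightarrow> mk S = mk T \<longleftrightarrow> S = T"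
  using el_mk by metis

lemma codedI: "\<not> Ur y \<Longrightarrow> el y = S \<Longrightarrow> coded S"
  unfolding coded_def by blast

lemma mk_el:
  assumes "\<not> Ur y"
  shows "mk (el y) = y"
proof -
  have "coded (el y)" using codedI[OF assms refl] .
  then show ?thesis using assms by (intro el_ext not_Ur_mk el_mk)
qed

lemma dfn_sat1:
  assumes "dfnU (\<lambda>w. P (w 0))"
  obtains \<phi> v where "\<And>z. sat E Ur (v(0 := z)) \<phi> = P z"
proof -
  obtain R' c where R: "fo E Ur R'" "(\<lambda>w. P (w 0)) = (\<lambda>w. R' (merge c w))"
    using assms unfolding dfn_def by (elim exE conjE)
  then obtain \<phi> where \<phi>: "\<forall>v. sat E Ur v \<phi> = R' v" unfolding fo_def by (elim exE)
  have m: "merge c ((\<lambda>_. undefined)(0 := z)) = (merge c (\<lambda>_. undefined))(0 := z)" for z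
    by (auto simp: merge_def fun_eq_iff elim!: evenE)
  have "sat E Ur ((merge c (\<lambda>_. undefined))(0 := z)) \<phi> = P z" for z
    using fun_cong[OF R(2), of "(\<lambda>_. undefined)(0 := z)"] unfolding m using \<phi> by simp
  then show thesis by (rule that)
qed

text \<open>\<open>merge\<close> puts variable 1 at place 2, which is why the second distinguished
  variable of the formula is 2.\<close>

lemma dfn_sat2:
  assumes "dfnU (\<lambda>w. P (w 0) (w 1))"
  obtains \<phi> v where "\<And>z y. sat E Ur (v(0 := z, 2 := y)) \<phi> = P z y"
proof -
  obtain R' c where R: "fo E Ur R'" "(\<lambda>w. P (w 0) (w 1)) = (\<lambda>w. R' (merge c w))"
    using assms unfolding dfn_def by (elim exE conjE)
  then obtain \<phi> where \<phi>: "\<forall>v. sat E Ur v \<phi> = R' v" unfolding fo_def by (elim exE)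
  have m: "merge c ((\<lambda>_. undefined)(0 := z, 1 := y)) = (merge c (\<lambda>_. undefined))(0 := z, 2 := y)" for z y
    by (auto simp: merge_def fun_eq_iff elim!: evenE)
  have "sat E Ur ((merge c (\<lambda>_. undefined))(0 := z, 2 := y)) \<phi> = P z y" for z y
    using fun_cong[OF R(2), of "(\<lambda>_. undefined)(0 := z, 1 := y)"] unfolding m using \<phi> by simp
  then show thesis by (rule that)
qed

lemma coded_sep:
  assumes "coded S" "dfnU (\<lambda>w. P (w 0))"
  shows "coded {x \<in> S. P x}"
proof -
  obtain y where y: "\<not> Ur y" "el y = S" using assms unfolding coded_def by blast
  obtain \<phi> v where \<phi>: "\<And>z. sat E Ur (v(0 := z)) \<phi> = P z" using dfn_sat1[OF assms(2)] by blast
  have "separation E Ur" using zfu by (simp add: ZFU_R_def)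
  then obtain u where "\<not> Ur u" "\<forall>z. E z u \<longleftrightarrow> E z y \<and> sat E Ur (v(0 := z)) \<phi>"
    unfolding separation_def is_set_def using y(1) by meson
  then show ?thesis using y(2) by (intro codedI[of u]) (auto simp: \<phi> el_def)
qed

lemma coded_subset:
  assumes "coded S" "dfnU (\<lambda>w. P (w 0))" "\<And>x. P x \<Longrightarrow> x \<in> S"
  shows "coded {x. P x}"
proof -
  have "{x. P x} = {x \<in> S. P x}" using assms(3) by blast
  then show ?thesis using coded_sep[OF assms(1,2)] by simp
qed

lemma coded_image:
  assumes "coded S" "dtermU (\<lambda>w. F (w 0))"
  shows "coded (F ` S)"
proof -
  obtain x where x: "\<not> Ur x" "el x = S" using assms unfolding coded_def by blast
  have "dfnU (\<lambda>w. w 1 = F (w 0))"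
    using dfn_rename[OF assms(2)[unfolded dterm_def], of "\<lambda>n. if n = 0 then 1 else 0"] by simp
  then obtain \<phi> v where \<phi>: "\<And>z y. sat E Ur (v(0 := z, 2 := y)) \<phi> = (y = F z)"
    by (rule dfn_sat2[of "\<lambda>z y. y = F z"]) (rule that)
  have rep: "replacement E Ur" using zfu by (simp add: ZFU_R_def)
  have "\<exists>y. \<not> Ur y \<and> (\<forall>b. E b y \<longleftrightarrow> (\<exists>a. E a x \<and> sat E Ur (v(0 := a, 2 := b)) \<phi>))"
    by (rule rep[unfolded replacement_def is_set_def, rule_format,
          where i = 0 and j = 2 and x = x and v = v and \<phi> = \<phi>])
      (use x(1) \<phi> in simp_all)
  then obtain u where "\<not> Ur u" "\<forall>b. E b u \<longleftrightarrow> (\<exists>a. E a x \<and> b = F a)"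
    unfolding \<phi> by (elim exE conjE)
  then show ?thesis using x(2) by (intro codedI[of u]) (auto simp: el_def)
qed

lemma coded_empty: "coded {}"
proof -
  have "infinity E Ur" using zfu by (simp add: ZFU_R_def)
  then show ?thesis unfolding infinity_def is_set_def coded_def el_def by auto
qed

lemma coded_el: "coded (el y)"
  using coded_empty el_Ur codedI by metis

lemma coded_pair: "coded {a, b}"
proof -
  have "pairing E Ur" using zfu by (simp add: ZFU_R_def)
  then obtain p where "\<not> Ur p" "\<forall>z. E z p \<longleftrightarrow> z = a \<or> z = b"
    unfolding pairing_def is_set_def by blast
  then show ?thesis by (intro codedI[of p]) (auto simp: el_def)
qed

lemma coded_single: "coded {a}"
  using coded_pair[of a a] by simp

lemma coded_Union:
  assumes "coded S"
  shows "coded (\<Union>y\<in>S. el y)"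
proof -
  have "union_axiom E Ur" using zfu by (simp add: ZFU_R_def)
  then obtain u where "\<not> Ur u" "\<forall>z. E z u \<longleftrightarrow> (\<exists>y. E y (mk S) \<and> E z y)"
    unfolding union_axiom_def is_set_def using not_Ur_mk[OF assms] by blast
  then show ?thesis using el_mk[OF assms] by (intro codedI[of u]) (auto simp: el_def)
qed

lemma coded_Un:
  assumes "coded S" "coded T"
  shows "coded (S \<union> T)"
  using coded_Union[OF coded_pair[of "mk S" "mk T"]] by (simp add: el_mk assms)

lemma coded_insert: "coded S \<Longrightarrow> coded (insert a S)"
  using coded_Un[OF coded_single] by simp

lemma coded_Pow: "coded {z. \<not> Ur z \<and> el z \<subseteq> el x}"
proof -
  have "\<exists>p. \<not> Ur p \<and> (\<forall>z. E z p \<longleftrightarrow> subset_of E Ur z y)" if "\<not> Ur y" for y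
    using zfu that unfolding ZFU_R_def powerset_def is_set_def by blast
  from this[OF not_Ur_mk[OF coded_el[of x]]]
  obtain p where "\<not> Ur p" "\<forall>z. E z p \<longleftrightarrow> subset_of E Ur z (mk (el x))" by blast
  then show ?thesis
    using el_mk[OF coded_el[of x]] not_Ur_mk[OF coded_el[of x]]
    by (intro codedI[of p]) (auto simp: el_def subset_of_def is_set_def)
qed

lemma foundation_coded:
  assumes "coded S" "S \<noteq> {}"
  obtains y where "y \<in> S" "el y \<inter> S = {}"
proof -
  obtain x where x: "\<not> Ur x" "el x = S" using assms unfolding coded_def by blast
  then have "\<exists>y. E y x \<and> (\<forall>z. E z x \<longrightarrow> \<not> E z y)"
    using zfu assms(2) unfolding ZFU_R_def foundation_def is_set_def el_def by blast
  then show thesis using x that by (auto simp: el_def)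
qed

lemma mem_irrefl: "x \<notin> el x"
  using foundation_coded[OF coded_single[of x]] by blast

lemma mem_asym: "x \<in> el y \<Longrightarrow> y \<notin> el x"
  using foundation_coded[OF coded_pair[of x y]] by blast

lemma mem_no_3_cycle: "x \<in> el y \<Longrightarrow> y \<in> el z \<Longrightarrow> z \<notin> el x"
  using foundation_coded[OF coded_insert[OF coded_pair[of x y], of z]] by blast

definition opair :: "'u \<Rightarrow> 'u \<Rightarrow> 'u" where
  "opair a b = mk {mk {a}, mk {a, b}}"

lemma dterm_pair [dfn_intros]:
  assumes "dtermU t" "dtermU s"
  shows "dtermU (\<lambda>w. mk {t w, s w})"
proof -
  have eq: "{t w, s w} = {x. x = t w \<or> x = s w}" for w by auto
  show ?thesis unfolding eq by (intro dfn_intros dterm_rename[OF assms(1)] dterm_rename[OF assms(2)])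
qed

lemma dterm_insert [dfn_intros]:
  assumes "dtermU t" "dtermU s"
  shows "dtermU (\<lambda>w. mk (insert (t w) (el (s w))))"
proof -
  have eq: "insert (t w) (el (s w)) = {x. x = t w \<or> x \<in> el (s w)}" for w by auto
  show ?thesis unfolding eq by (intro dfn_intros dterm_rename[OF assms(1)] dterm_rename[OF assms(2)])
qed

lemma dterm_Union [dfn_intros]:
  assumes "dtermU t"
  shows "dtermU (\<lambda>w. mk (\<Union>y\<in>el (t w). el y))"
proof -
  have eq: "(\<Union>y\<in>el (t w). el y) = {x. \<exists>y\<in>el (t w). x \<in> el y}" for w by auto
  show ?thesis unfolding eq by (intro dfn_intros dterm_rename[OF assms])
qed

lemma dterm_opair [dfn_intros]: "dtermU t \<Longrightarrow> dtermU s \<Longrightarrow> dtermU (\<lambda>w. opair (t w) (s w))"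
  unfolding opair_def using dterm_pair[of t t] by (simp add: dterm_pair)

lemma opair_inject: "opair a b = opair c d \<longleftrightarrow> a = c \<and> b = d"
  unfolding opair_def by (auto simp: mk_inject coded_pair coded_single doubleton_eq_iff)

lemma is_opair_iff: "is_opair E Ur p a b \<longleftrightarrow> p = opair a b"
proof -
  have up: "is_upair E Ur z x y \<longleftrightarrow> z = mk {x, y}" for x y z
    unfolding is_upair_def is_set_def
    using el_ext[of z "mk {x, y}"] not_Ur_mk[OF coded_pair[of x y]] el_mk[OF coded_pair[of x y]]
    by (auto simp: el_def)
  show ?thesis
    unfolding is_opair_def is_set_def opair_def up
    using el_ext[of p "mk {mk {a}, mk {a, b}}"] not_Ur_mk[OF coded_pair[of "mk {a}" "mk {a, b}"]]
      el_mk[OF coded_pair[of "mk {a}" "mk {a, b}"]]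
    by (auto simp: el_def)
qed

end

section \<open>Natural numbers and transitive closure\<close>

context zfu
begin

definition zer :: 'u where "zer = mk {}"

definition sc :: "'u \<Rightarrow> 'u" where "sc y = mk (insert y (el y))"

lemma dterm_sc [dfn_intros]: "dtermU t \<Longrightarrow> dtermU (\<lambda>w. sc (t w))"
  unfolding sc_def by (intro dfn_intros)

lemma el_zer: "el zer = {}" and not_Ur_zer: "\<not> Ur zer"
  unfolding zer_def by (simp_all add: el_mk not_Ur_mk coded_empty)

lemma el_sc: "el (sc y) = insert y (el y)" and not_Ur_sc: "\<not> Ur (sc y)"
  unfolding sc_def by (simp_all add: el_mk not_Ur_mk coded_insert coded_el)

lemma sc_neq_zer: "sc y \<noteq> zer"
  using el_sc[of y] el_zer by auto

lemma sc_inject: "sc x = sc y \<longleftrightarrow> x = y"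
proof
  assume "sc x = sc y"
  then have "insert x (el x) = insert y (el y)" using el_sc by metis
  then have "x \<in> insert y (el y)" "y \<in> insert x (el x)" by (metis insertI1)+
  then show "x = y" using mem_asym[of x y] by auto
qed simp

definition inductive_object :: "'u \<Rightarrow> bool" where
  "inductive_object I \<longleftrightarrow> zer \<in> el I \<and> (\<forall>y\<in>el I. sc y \<in> el I)"

text \<open>The model's own natural numbers, as the intersection of all inductive objects. They may
  be nonstandard, so \<open>nat\<close> cannot stand in for them, and induction along them is
  available for definable predicates.\<close>

definition omega :: 'u where
  "omega = mk {n. \<forall>I. inductive_object I \<longrightarrow> n \<in> el I}"

lemma el_omega: "el omega = {n. \<forall>I. inductive_object I \<longrightarrow> n \<in> el I}"
proof -
  have "infinity E Ur" using zfu by (simp add: ZFU_R_def)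
  then obtain w e where e: "E e w" "\<not> Ur e" "\<forall>z. \<not> E z e"
    and w: "\<forall>y. E y w \<longrightarrow> (\<exists>s. E s w \<and> \<not> Ur s \<and> (\<forall>z. E z s \<longleftrightarrow> E z y \<or> z = y))"
    unfolding infinity_def is_set_def by (elim exE conjE)
  have "e = zer" by (intro el_ext e(2) not_Ur_zer) (use e(3) in \<open>simp add: el_zer, simp add: el_def\<close>)
  then have "zer \<in> el w" using e(1) by (simp add: el_def)
  moreover have "sc y \<in> el w" if "y \<in> el w" for y
  proof -
    obtain s where s: "E s w" "\<not> Ur s" "\<forall>z. E z s \<longleftrightarrow> E z y \<or> z = y"
      using w \<open>y \<in> el w\<close> unfolding el_def mem_Collect_eq by blast
    have "el s = insert y (el y)" using s(3) by (auto simp: el_def)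
    then have "s = sc y" by (intro el_ext s(2) not_Ur_sc) (simp add: el_sc)
    then show ?thesis using s(1) by (simp add: el_def)
  qed
  ultimately have "inductive_object w" unfolding inductive_object_def by simp
  then have "coded {n. \<forall>I. inductive_object I \<longrightarrow> n \<in> el I}"
    unfolding inductive_object_def by (intro coded_subset[OF coded_el[of w]] dfn_intros) simp
  then show ?thesis unfolding omega_def by (rule el_mk)
qed

abbreviation "W \<equiv> el omega"

lemma zer_W: "zer \<in> W"
  unfolding el_omega inductive_object_def by blast

lemma sc_W: "n \<in> W \<Longrightarrow> sc n \<in> W"
  unfolding el_omega inductive_object_def by blast

lemma omega_induct:
  assumes "dfnU (\<lambda>w. P (w 0))" "n \<in> W" "P zer" "\<And>n. n \<in> W \<Longrightarrow> P n \<Longrightarrow> P (sc n)"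
  shows "P n"
proof -
  have "coded {n \<in> W. P n}" by (rule coded_sep[OF coded_el assms(1)])
  note el = el_mk[OF this]
  have "inductive_object (mk {n \<in> W. P n})"
    unfolding inductive_object_def el using assms(3,4) zer_W sc_W by blast
  then have "n \<in> el (mk {n \<in> W. P n})" using assms(2) unfolding el_omega by blast
  then show ?thesis unfolding el by blast
qed

lemma omega_recursion:
  assumes G: "dtermU (\<lambda>w. G (w 0))"
  obtains s where "dtermU (\<lambda>w. s (w 0))" "s zer = x0" "\<And>n. n \<in> W \<Longrightarrow> s (sc n) = G (s n)"
proof -
  \<comment> \<open>\<open>d\<close> is a derivation: each of its pairs is the initial one or
    follows from another of its pairs. It need not be a function, and adding one pair extends it.
    Uniqueness of the derived value comes afterwards by induction, because \<open>sc\<close> is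
    injective and never yields \<open>zer\<close>.\<close>
  define \<Phi> where "\<Phi> n u \<longleftrightarrow> (\<exists>d. opair n u \<in> el d \<and> (\<forall>k v. opair k v \<in> el d \<longrightarrow>
    (k = zer \<and> v = x0) \<or> (\<exists>j y. opair j y \<in> el d \<and> k = sc j \<and> v = G y)))" for n u
  have D: "dfnU (\<lambda>w. \<Phi> (w i) (w j))" for i j
    unfolding \<Phi>_def by (intro dfn_intros dterm_subst1[OF G])
  have zer: "\<Phi> zer u \<longleftrightarrow> u = x0" for u
  proof
    show "u = x0" if "\<Phi> zer u" using that sc_neq_zer unfolding \<Phi>_def by metis
    have "\<Phi> zer x0"
      unfolding \<Phi>_def
      by (rule exI[of _ "mk {opair zer x0}"]) (simp add: el_mk coded_single opair_inject)
    then show "\<Phi> zer u" if "u = x0" using that by simp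
  qed
  have sc: "\<Phi> (sc n) u \<longleftrightarrow> (\<exists>y. \<Phi> n y \<and> u = G y)" for n u
  proof
    assume "\<Phi> (sc n) u"
    then obtain d where d: "opair (sc n) u \<in> el d" "\<forall>k v. opair k v \<in> el d \<longrightarrow>
      (k = zer \<and> v = x0) \<or> (\<exists>j y. opair j y \<in> el d \<and> k = sc j \<and> v = G y)"
      unfolding \<Phi>_def by blast
    then obtain j y where "opair j y \<in> el d" "sc n = sc j" "u = G y" using sc_neq_zer by metis
    then show "\<exists>y. \<Phi> n y \<and> u = G y" unfolding \<Phi>_def sc_inject using d(2) by blast
  next
    assume "\<exists>y. \<Phi> n y \<and> u = G y"
    then obtain y d where y: "u = G y" and d: "opair n y \<in> el d" "\<forall>k v. opair k v \<in> el d \<longrightarrow>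
      (k = zer \<and> v = x0) \<or> (\<exists>j y. opair j y \<in> el d \<and> k = sc j \<and> v = G y)"
      unfolding \<Phi>_def by blast
    show "\<Phi> (sc n) u"
      unfolding \<Phi>_def
    proof (intro exI[of _ "mk (insert (opair (sc n) u) (el d))"] conjI allI impI)
      note el = el_mk[OF coded_insert[OF coded_el], of "opair (sc n) u" d]
      show "opair (sc n) u \<in> el (mk (insert (opair (sc n) u) (el d)))" by (simp add: el)
      fix k v
      assume "opair k v \<in> el (mk (insert (opair (sc n) u) (el d)))"
      then consider "k = sc n" "v = u" | "opair k v \<in> el d" by (auto simp: el opair_inject)
      then show "(k = zer \<and> v = x0) \<or>
        (\<exists>j y. opair j y \<in> el (mk (insert (opair (sc n) u) (el d))) \<and> k = sc j \<and> v = G y)"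
      proof cases
        case 1
        then show ?thesis unfolding el using y d(1) by blast
      next
        case 2
        then show ?thesis unfolding el using d(2) by blast
      qed
    qed
  qed
  have ex1: "\<exists>!u. \<Phi> n u" if "n \<in> W" for n
    unfolding Ex1_def
    by (rule omega_induct[OF _ that]) (intro dfn_intros D, use zer sc in blast, use sc in blast)
  define s where "s n = the1 (\<Phi> n)" for n
  have s: "\<Phi> n u \<Longrightarrow> n \<in> W \<Longrightarrow> s n = u" for n u
    unfolding s_def using ex1 by (intro the1_eq) blast+
  show thesis
  proof (rule that)
    show "dtermU (\<lambda>w. s (w 0))" unfolding s_def by (intro dfn_intros D)
    show "s zer = x0" by (rule s) (simp_all add: zer zer_W)
    fix n assume n: "n \<in> W"
    then have "\<Phi> n (s n)" unfolding s_def by (rule the1I[OF ex1])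
    then show "s (sc n) = G (s n)" using n by (intro s sc_W) (auto simp: sc)
  qed
qed

section \<open>Transitive closure and induction on membership\<close>

definition transitive :: "'u \<Rightarrow> bool" where
  "transitive t \<longleftrightarrow> (\<forall>y\<in>el t. \<forall>z\<in>el y. z \<in> el t)"

lemma transitiveD: "transitive t \<Longrightarrow> y \<in> el t \<Longrightarrow> z \<in> el y \<Longrightarrow> z \<in> el t"
  unfolding transitive_def by blast

text \<open>Iterate the union operation from the singleton of \<open>x\<close>. The union of all
  stages is transitive, since the elements of a member of one stage lie in the next.\<close>

lemma ex_transitive: "\<exists>t. x \<in> el t \<and> transitive t"
proof -
  have "dtermU (\<lambda>w. mk (\<Union>y\<in>el (w 0). el y))" by (intro dfn_intros)
  then obtain s where s: "dtermU (\<lambda>w. s (w 0))" "s zer = mk {x}"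
    "\<And>n. n \<in> W \<Longrightarrow> s (sc n) = mk (\<Union>y\<in>el (s n). el y)"
    by (rule omega_recursion[where ?x0.0 = "mk {x}"]) (rule that)
  define T where "T = (\<Union>n\<in>W. el (s n))"
  have "T = (\<Union>y\<in>s ` W. el y)" unfolding T_def by simp
  then have "coded T" using coded_Union[OF coded_image[OF coded_el s(1)]] by simp
  note el = el_mk[OF this]
  have "x \<in> el (s zer)" unfolding s(2) by (simp add: el_mk coded_single)
  then have "x \<in> T" unfolding T_def using zer_W by blast
  moreover have "z \<in> T" if "y \<in> T" "z \<in> el y" for y z
  proof -
    obtain n where n: "n \<in> W" "y \<in> el (s n)" using \<open>y \<in> T\<close> unfolding T_def by blast
    have "z \<in> el (s (sc n))"
      unfolding s(3)[OF n(1)] el_mk[OF coded_Union[OF coded_el]] using n(2) \<open>z \<in> el y\<close> by blast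
    then show ?thesis unfolding T_def using sc_W[OF n(1)] by blast
  qed
  ultimately show ?thesis
    by (intro exI[of _ "mk T"]) (auto simp: transitive_def el)
qed

text \<open>Contrary to the usual convention, the closure of \<open>x\<close> contains \<open>x\<close> itself.\<close>

definition tc :: "'u \<Rightarrow> 'u" where
  "tc x = mk {y. \<forall>t. x \<in> el t \<longrightarrow> transitive t \<longrightarrow> y \<in> el t}"

lemma el_tc: "el (tc x) = {y. \<forall>t. x \<in> el t \<longrightarrow> transitive t \<longrightarrow> y \<in> el t}"
proof -
  obtain t where t: "x \<in> el t" "transitive t" using ex_transitive by blast
  have "coded {y. \<forall>t. x \<in> el t \<longrightarrow> transitive t \<longrightarrow> y \<in> el t}"
    by (rule coded_subset[OF coded_el[of t]], unfold transitive_def, intro dfn_intros)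
      (use t transitive_def in blast)
  then show ?thesis unfolding tc_def by (rule el_mk)
qed

lemma self_tc: "x \<in> el (tc x)"
  unfolding el_tc by blast

lemma transitive_tc: "transitive (tc x)"
  unfolding transitive_def el_tc by blast

lemma tc_least: "x \<in> el t \<Longrightarrow> transitive t \<Longrightarrow> el (tc x) \<subseteq> el t"
  unfolding el_tc by blast

text \<open>Foundation speaks of sets only. The closure of \<open>x\<close> cuts the counterexamples
  down to a set, by Separation for the definable \<open>P\<close>, and transitivity makes a minimal
  member of it a counterexample all of whose elements satisfy \<open>P\<close>.\<close>

lemma mem_induct:
  assumes "dfnU (\<lambda>w. P (w 0))" "\<And>x. (\<And>y. y \<in> el x \<Longrightarrow> P y) \<Longrightarrow> P x"
  shows "P x"
proof (rule ccontr)
  assume x: "\<not> P x"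
  have "coded {y \<in> el (tc x). \<not> P y}"
    by (intro coded_sep[OF coded_el] dfn_intros assms(1))
  moreover have "{y \<in> el (tc x). \<not> P y} \<noteq> {}" using x self_tc by blast
  ultimately obtain y where y: "y \<in> el (tc x)" "\<not> P y" "el y \<inter> {y \<in> el (tc x). \<not> P y} = {}"
    by (rule foundation_coded) blast
  then show False using assms(2)[of y] transitiveD[OF transitive_tc y(1)] by blast
qed

end

section \<open>Automorphisms\<close>

text \<open>The automorphisms used later are exchanges. For an involution images coincide with
  preimages, and bijectivity comes for free.\<close>

locale involutive_automorphism =
  fixes E :: "'u \<Rightarrow> 'u \<Rightarrow> bool" and Ur :: "'u \<Rightarrow> bool" and g :: "'u \<Rightarrow> 'u"
  assumes involution: "g (g x) = x"
    and E_iff: "E (g x) (g y) \<longleftrightarrow> E x y"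
    and Ur_iff: "Ur (g x) \<longleftrightarrow> Ur x"
begin

lemma eq_iff: "g x = g y \<longleftrightarrow> x = y"
  using involution by metis

lemma mem_image_iff: "x \<in> g ` X \<longleftrightarrow> g x \<in> X"
  using involution by (metis image_iff)

lemma image_image: "g ` g ` X = X"
  using involution by (auto simp: mem_image_iff)

lemma all_iff: "(\<forall>x. P (g x)) \<longleftrightarrow> (\<forall>x. P x)"
  using involution by metis

lemma upd: "(\<lambda>n. g (v n))(i := g x) = (\<lambda>n. g ((v(i := x)) n))"
  by auto

lemma sat_iff: "sat E Ur (\<lambda>n. g (v n)) \<phi> \<longleftrightarrow> sat E Ur v \<phi>"
proof (induction \<phi> arbitrary: v)
  case (All i \<phi>)
  show ?case
    unfolding sat.simps all_iff[of "\<lambda>x. sat E Ur ((\<lambda>n. g (v n))(i := x)) \<phi>", symmetric] upd All.IH ..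
qed (simp_all add: E_iff Ur_iff eq_iff)

text \<open>The same formula defines the image, only with the parameter moved. Hence the image of a
  definable class is definable, and a class whose parameter is fixed is itself fixed.\<close>

lemma image_Collect_sat:
  "g ` {x. sat E Ur ((\<lambda>_. z)(0 := x)) \<psi>} = {x. sat E Ur ((\<lambda>_. g z)(0 := x)) \<psi>}"
proof -
  have "sat E Ur ((\<lambda>_. z)(0 := g x)) \<psi> \<longleftrightarrow> sat E Ur ((\<lambda>_. g z)(0 := x)) \<psi>" for x
    using sat_iff[of "(\<lambda>_. z)(0 := g x)" \<psi>] unfolding upd[symmetric] involution ..
  then show ?thesis by (auto simp: mem_image_iff set_eq_iff)
qed

lemma image_definable: "definable_class E Ur X \<Longrightarrow> definable_class E Ur (g ` X)"
  unfolding definable_class_def using image_Collect_sat by metis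

lemma all_class_iff:
  "(\<forall>X. definable_class E Ur X \<longrightarrow> P (g ` X)) \<longleftrightarrow> (\<forall>X. definable_class E Ur X \<longrightarrow> P X)"
  using image_image image_definable by metis

lemma sat2_iff: "sat2 E Ur (\<lambda>n. g (v n)) (\<lambda>k. g ` V k) \<phi> \<longleftrightarrow> sat2 E Ur v V \<phi>"
proof (induction \<phi> arbitrary: v V)
  case (All2 i \<phi>)
  show ?case
    unfolding sat2.simps upd All2.IH
      all_iff[of "\<lambda>x. sat2 E Ur ((\<lambda>n. g (v n))(i := x)) (\<lambda>k. g ` V k) \<phi>", symmetric] ..
next
  case (AllC k \<phi>)
  have "(\<lambda>k. g ` V k)(k := g ` X) = (\<lambda>l. g ` (V(k := X)) l)" for X
    by (simp add: fun_eq_iff)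
  then show ?case
    unfolding sat2.simps
      all_class_iff[of "\<lambda>X. sat2 E Ur (\<lambda>n. g (v n)) ((\<lambda>k. g ` V k)(k := X)) \<phi>", symmetric]
    by (simp only: AllC.IH)
next
  case (EqC k l)
  show ?case using image_image by (simp, metis)
qed (simp_all add: E_iff Ur_iff eq_iff mem_image_iff involution)

lemma definable_map_equivariant:
  assumes map: "\<And>X y. definable_class E Ur X \<Longrightarrow>
      ext X = y \<longleftrightarrow> sat2 E Ur (\<lambda>_. y) ((\<lambda>_. P)(0 := X)) \<phi>"
    and "g ` P = P" "definable_class E Ur X"
  shows "ext (g ` X) = g (ext X)"
proof -
  have eq: "(\<lambda>k. g ` ((\<lambda>_. P)(0 := X)) k) = (\<lambda>_. P)(0 := g ` X)"
    using assms(2) by (simp add: fun_eq_iff)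
  have "sat2 E Ur (\<lambda>_. ext X) ((\<lambda>_. P)(0 := X)) \<phi>"
    using map[OF assms(3), of "ext X"] by simp
  then have "sat2 E Ur (\<lambda>_. g (ext X)) ((\<lambda>_. P)(0 := g ` X)) \<phi>"
    using sat2_iff[of "\<lambda>_. ext X" "(\<lambda>_. P)(0 := X)" \<phi>] unfolding eq by simp
  then show ?thesis using map[OF image_definable[OF assms(3)]] by simp
qed

end

section \<open>Recursion on membership and the extension of involutions\<close>

context zfu
begin

lemma mem_recursion:
  assumes H: "dtermU (\<lambda>w. H (w 0) (w 1))"
  obtains s where "dtermU (\<lambda>w. s (w 0))" "\<And>x. s x = H x (mk (s ` el x))"
proof -
  \<comment> \<open>Again \<open>d\<close> is a derivation: \<open>v\<close> comes from a set
    \<open>m\<close> of values that \<open>d\<close> attaches to the elements of \<open>k\<close>.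
    The two inclusions describe \<open>m\<close> without forming an image, which would presuppose
    that values are unique.\<close>
  define J where "J d k v \<longleftrightarrow> (\<exists>m. \<not> Ur m \<and> v = H k m \<and>
      (\<forall>k'\<in>el k. \<exists>v'\<in>el m. opair k' v' \<in> el d) \<and> (\<forall>v'\<in>el m. \<exists>k'\<in>el k. opair k' v' \<in> el d))" for d k v
  define \<Phi> where "\<Phi> x u \<longleftrightarrow> (\<exists>d. opair x u \<in> el d \<and> (\<forall>k v. opair k v \<in> el d \<longrightarrow> J d k v))" for x u
  have D: "dfnU (\<lambda>w. \<Phi> (w i) (w j))" for i j
    unfolding \<Phi>_def J_def by (intro dfn_intros dterm_subst2[OF H])
  have local: "\<exists>m. \<not> Ur m \<and> u = H x m \<and>
      (\<forall>k\<in>el x. \<exists>v\<in>el m. \<Phi> k v) \<and> (\<forall>v\<in>el m. \<exists>k\<in>el x. \<Phi> k v)" if "\<Phi> x u" for x u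
  proof -
    from that obtain d where d: "opair x u \<in> el d" "\<forall>k v. opair k v \<in> el d \<longrightarrow> J d k v"
      unfolding \<Phi>_def by blast
    have \<Phi>: "\<Phi> k v" if "opair k v \<in> el d" for k v using that d(2) unfolding \<Phi>_def by blast
    have "J d x u" using d by blast
    then obtain m where "\<not> Ur m" "u = H x m" "\<forall>k\<in>el x. \<exists>v\<in>el m. opair k v \<in> el d"
      "\<forall>v\<in>el m. \<exists>k\<in>el x. opair k v \<in> el d"
      unfolding J_def by (elim exE conjE)
    then show ?thesis using \<Phi> by (intro exI[of _ m] conjI) blast+
  qed
  have unique: "\<forall>u u'. \<Phi> x u \<longrightarrow> \<Phi> x u' \<longrightarrow> u = u'" for x
  proof (rule mem_induct[of "\<lambda>x. \<forall>u u'. \<Phi> x u \<longrightarrow> \<Phi> x u' \<longrightarrow> u = u'"])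
    show "dfnU (\<lambda>w. \<forall>u u'. \<Phi> (w 0) u \<longrightarrow> \<Phi> (w 0) u' \<longrightarrow> u = u')" by (intro dfn_intros D)
    fix x
    assume IH: "\<And>y. y \<in> el x \<Longrightarrow> \<forall>u u'. \<Phi> y u \<longrightarrow> \<Phi> y u' \<longrightarrow> u = u'"
    show "\<forall>u u'. \<Phi> x u \<longrightarrow> \<Phi> x u' \<longrightarrow> u = u'"
    proof (intro allI impI)
      fix u u'
      assume u: "\<Phi> x u" and u': "\<Phi> x u'"
      from local[OF u] obtain m where m: "\<not> Ur m" "u = H x m" "\<forall>k\<in>el x. \<exists>v\<in>el m. \<Phi> k v" "\<forall>v\<in>el m. \<exists>k\<in>el x. \<Phi> k v"
        by (elim exE conjE)
      from local[OF u'] obtain m' where m': "\<not> Ur m'" "u' = H x m'" "\<forall>k\<in>el x. \<exists>v\<in>el m'. \<Phi> k v" "\<forall>v\<in>el m'. \<exists>k\<in>el x. \<Phi> k v"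
        by (elim exE conjE)
      have "el m = el m'"
      proof (intro equalityI subsetI)
        fix v assume "v \<in> el m"
        then obtain k where k: "k \<in> el x" "\<Phi> k v" using m(4) by blast
        then obtain v' where v': "v' \<in> el m'" "\<Phi> k v'" using m'(3) by blast
        then have "v = v'" using IH[OF k(1)] k(2) by blast
        then show "v \<in> el m'" using v' by simp
      next
        fix v assume "v \<in> el m'"
        then obtain k where k: "k \<in> el x" "\<Phi> k v" using m'(4) by blast
        then obtain v' where v': "v' \<in> el m" "\<Phi> k v'" using m(3) by blast
        then have "v = v'" using IH[OF k(1)] k(2) by blast
        then show "v \<in> el m" using v' by simp
      qed
      then have "m = m'" using m(1) m'(1) by (intro el_ext)
      then show "u = u'" using m(2) m'(2) by simp
    qed
  qed
  define s where "s x = the1 (\<Phi> x)" for x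
  have s: "s x = u" if "\<Phi> x u" for x u
    unfolding s_def using that unique by (intro the1_eq) blast+
  have Ds: "dtermU (\<lambda>w. s (w i))" for i
    unfolding s_def by (intro dfn_intros D)
  have total: "\<Phi> x (s x)" for x
  proof (rule mem_induct[of "\<lambda>x. \<Phi> x (s x)"])
    have Ds': "dtermU t \<Longrightarrow> dtermU (\<lambda>w. s (t w))" for t by (rule dterm_subst1[OF Ds])
    have D': "dtermU t \<Longrightarrow> dfnU (\<lambda>w. \<Phi> (t w) (s (t w)))" for t
      by (rule dfn_subst2[of _ _ \<Phi>, OF D _ Ds'])
    show D0: "dfnU (\<lambda>w. \<Phi> (w 0) (s (w 0)))" by (intro D' dfn_intros)
    fix x
    assume IH: "\<And>y. y \<in> el x \<Longrightarrow> \<Phi> y (s y)"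
    define m where "m = mk (s ` el x)"
    have m: "\<not> Ur m" "el m = s ` el x"
      unfolding m_def by (rule not_Ur_mk el_mk; rule coded_image[OF coded_el Ds])+
    \<comment> \<open>No derivations for the elements of \<open>x\<close> are chosen; the canonical
      values \<open>s k\<close> are collected wherever \<open>\<Phi>\<close> already holds inside
      the closure. By \<open>local\<close> and transitivity this part is closed under elements, so
      the collection together with the new pair is a derivation.\<close>
    define K where "K = {k \<in> el (tc x). \<Phi> k (s k)}"
    define d where "d = mk (insert (opair x (H x m)) ((\<lambda>k. opair k (s k)) ` K))"
    have "coded ((\<lambda>k. opair k (s k)) ` K)"
      unfolding K_def by (intro coded_image coded_sep coded_el D0 dfn_intros Ds)
    from el_mk[OF coded_insert[OF this]]
    have d: "el d = insert (opair x (H x m)) ((\<lambda>k. opair k (s k)) ` K)" unfolding d_def .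
    have sub: "y \<in> el (tc x)" if "y \<in> el x" for y
      using transitiveD[OF transitive_tc self_tc that] .
    have "J d k v" if kv: "opair k v \<in> el d" for k v
    proof -
      from kv consider "k = x" "v = H x m" | "k \<in> K" "v = s k" unfolding d by (auto simp: opair_inject)
      then show ?thesis
      proof cases
        case 1
        show ?thesis
          unfolding J_def 1 using m(1)
        proof (intro exI[of _ m] conjI ballI refl)
          fix k' assume k': "k' \<in> el x"
          then have "opair k' (s k') \<in> el d" unfolding d K_def using IH sub by blast
          then show "\<exists>v'\<in>el m. opair k' v' \<in> el d" unfolding m(2) using k' by blast
        next
          fix v' assume "v' \<in> el m"
          then obtain k' where k': "k' \<in> el x" "v' = s k'" unfolding m(2) by blast
          then have "opair k' v' \<in> el d" unfolding d K_def using IH sub by blast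
          then show "\<exists>k'\<in>el x. opair k' v' \<in> el d" using k' by blast
        qed
      next
        case 2
        have step: "opair k' v' \<in> el d" if "k' \<in> el k" "\<Phi> k' v'" for k' v'
        proof -
          have "k' \<in> el (tc x)" using that(1) 2(1) transitiveD[OF transitive_tc] unfolding K_def by blast
          then show ?thesis unfolding d K_def using that(2) s[OF that(2)] by blast
        qed
        have "\<Phi> k v" using 2 unfolding K_def by simp
        from local[OF this] obtain m' where "\<not> Ur m'" "v = H k m'"
          "\<forall>k'\<in>el k. \<exists>v\<in>el m'. \<Phi> k' v" "\<forall>v\<in>el m'. \<exists>k'\<in>el k. \<Phi> k' v" by (elim exE conjE)
        then show ?thesis unfolding J_def using step by (intro exI[of _ m'] conjI) blast+
      qed
    qed
    then have "\<Phi> x (H x m)" unfolding \<Phi>_def by (intro exI[of _ d]) (simp add: d)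
    then show "\<Phi> x (s x)" using s by metis
  qed
  show thesis
  proof (rule that)
    show "dtermU (\<lambda>w. s (w 0))" by (rule Ds)
    fix x
    obtain m where m: "\<not> Ur m" "s x = H x m" "\<forall>k\<in>el x. \<exists>v\<in>el m. \<Phi> k v" "\<forall>v\<in>el m. \<exists>k\<in>el x. \<Phi> k v"
      using local[OF total[of x]] by (elim exE conjE)
    have "el m = s ` el x"
    proof (intro equalityI subsetI)
      fix v assume "v \<in> el m"
      then obtain k where "k \<in> el x" "\<Phi> k v" using m(4) by blast
      then show "v \<in> s ` el x" using s[of k v] by blast
    next
      fix v assume "v \<in> s ` el x"
      then obtain k where k: "k \<in> el x" "v = s k" by blast
      then obtain v' where "v' \<in> el m" "\<Phi> k v'" using m(3) by blast
      then show "v \<in> el m" using s k(2) by metis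
    qed
    then show "s x = H x (mk (s ` el x))" using mk_el[OF m(1)] m(2) by simp
  qed
qed

lemma el_automorphism:
  assumes "involutive_automorphism E Ur s"
  shows "el (s x) = s ` el x"
proof -
  interpret involutive_automorphism E Ur s by (rule assms)
  have "y \<in> el (s x) \<longleftrightarrow> y \<in> s ` el x" for y
    using E_iff[of "s y" x] by (simp add: el_def mem_image_iff involution)
  then show ?thesis by blast
qed

text \<open>Letting \<open>s\<close> act elementwise on sets preserves membership by construction.
  That \<open>s\<close> is an involution spreads from the urelements to all objects by induction on
  membership, and it gives the converse implication for \<open>E\<close>.\<close>

lemma extend_involution:
  assumes F: "dtermU (\<lambda>w. F (w 0))"
    and F_Ur: "\<forall>a. Ur a \<longrightarrow> Ur (F a)" and FF: "\<forall>a. Ur a \<longrightarrow> F (F a) = a"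
  obtains s where "involutive_automorphism E Ur s" "dtermU (\<lambda>w. s (w 0))"
    "\<And>a. Ur a \<Longrightarrow> s a = F a"
proof -
  have "dtermU (\<lambda>w. if Ur (w 0) then F (w 0) else w 1)"
    by (intro dfn_intros F)
  then obtain s where Ds: "dtermU (\<lambda>w. s (w 0))"
    and s: "\<And>x. s x = (if Ur x then F x else mk (s ` el x))"
    by (rule mem_recursion[of "\<lambda>x m. if Ur x then F x else m"]) (rule that)
  have c: "coded (s ` el x)" for x by (rule coded_image[OF coded_el Ds])
  have s_Ur: "s a = F a" if "Ur a" for a using s[of a] that by simp
  have s_set: "s x = mk (s ` el x)" if "\<not> Ur x" for x using s[of x] that by simp
  have Ur_s: "Ur (s x) = Ur x" for x
    by (cases "Ur x") (simp_all add: s_Ur F_Ur s_set not_Ur_mk[OF c])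
  have el_s: "el (s x) = s ` el x" for x
  proof (cases "Ur x")
    case True
    then have "Ur (s x)" using Ur_s by simp
    then show ?thesis using True el_Ur by simp
  next
    case False
    then show ?thesis using s_set el_mk[OF c] by simp
  qed
  have inv: "s (s x) = x" for x
  proof (rule mem_induct[of "\<lambda>x. s (s x) = x"])
    show "dfnU (\<lambda>w. s (s (w 0)) = w 0)" by (intro dfn_intros dterm_subst1[OF Ds])
    fix x
    assume IH: "\<And>y. y \<in> el x \<Longrightarrow> s (s y) = y"
    show "s (s x) = x"
    proof (cases "Ur x")
      case True
      then show ?thesis using s_Ur F_Ur FF by simp
    next
      case False
      have "el (s (s x)) = el x" unfolding el_s using IH by (simp add: image_image)
      then show ?thesis using False Ur_s by (intro el_ext) simp_all
    qed
  qed
  have "E (s x) (s y)" if "E x y" for x y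
    using that el_s[of y] unfolding el_def by blast
  then have "E (s x) (s y) = E x y" for x y
    using inv by metis
  then have "involutive_automorphism E Ur s"
    using inv Ur_s by unfold_locales
  then show thesis using that Ds s_Ur by blast
qed

end

section \<open>Ordinals\<close>

context zfu
begin

text \<open>Foundation already yields irreflexivity and least elements, so beyond transitivity and
  the absence of urelements comparability suffices. The formula is also simple enough for the
  definability calculus.\<close>

definition ord :: "'u \<Rightarrow> bool" where
  "ord x \<longleftrightarrow> \<not> Ur x \<and> transitive x \<and> (\<forall>y\<in>el x. \<not> Ur y) \<and>
    (\<forall>y\<in>el x. \<forall>z\<in>el x. y \<in> el z \<or> y = z \<or> z \<in> el y)"

lemma dfn_ord [dfn_intros]:
  assumes "dtermU t"
  shows "dfnU (\<lambda>w. ord (t w))"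
proof -
  have "dfnU (\<lambda>w. ord (w 0))" unfolding ord_def transitive_def by (intro dfn_intros)
  then show ?thesis by (rule dfn_subst1[where R = ord, OF _ assms])
qed

lemma ord_comparable:
  "ord x \<Longrightarrow> y \<in> el x \<Longrightarrow> z \<in> el x \<Longrightarrow> y \<in> el z \<or> y = z \<or> z \<in> el y"
  unfolding ord_def by blast

lemma ord_transitive: "ord x \<Longrightarrow> y \<in> el x \<Longrightarrow> z \<in> el y \<Longrightarrow> z \<in> el x"
  unfolding ord_def transitive_def by blast

lemma ord_elem:
  assumes "ord x" "y \<in> el x"
  shows "ord y"
proof -
  have sub: "z \<in> el x" if "z \<in> el y" for z using ord_transitive[OF assms that] .
  have "c \<in> el y" if cb: "c \<in> el b" "b \<in> el y" for b c
  proof -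
    have "c \<in> el x" using ord_transitive[OF assms(1) sub[OF cb(2)] cb(1)] .
    then consider "c \<in> el y" | "c = y" | "y \<in> el c" using ord_comparable[OF assms(1) _ assms(2)] by blast
    then show ?thesis
    proof cases
      case 2
      then show ?thesis using cb mem_asym by blast
    next
      case 3
      then show ?thesis using mem_no_3_cycle[OF cb] by blast
    qed
  qed
  then show ?thesis
    using assms sub unfolding ord_def transitive_def by (intro conjI ballI) blast+
qed

lemma ord_imp_ordinal:
  assumes "ord x"
  shows "ordinal E Ur x"
proof -
  have x: "\<not> Ur x" and els: "\<And>y. y \<in> el x \<Longrightarrow> \<not> Ur y" using assms unfolding ord_def by blast+
  have t: "transitive_set E Ur x"
    unfolding transitive_set_def is_set_def
    using x ord_transitive[OF assms] by (auto simp: el_def)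
  have "subset_of E Ur x x" unfolding subset_of_def is_set_def using x by blast
  then have p: "pure_set E Ur x"
    unfolding pure_set_def in_trans_closure_def is_set_def using t x els by (auto simp: el_def)
  have "wellordered_by_mem E Ur x"
    unfolding wellordered_by_mem_def
  proof (intro conjI allI impI)
    fix a show "\<not> E a a" using mem_irrefl[of a] by (simp add: el_def)
  next
    fix a b c
    assume "E a x" "E b x" "E c x" and ab: "E a b" and bc: "E b c"
    then have "E a c \<or> a = c \<or> E c a" using ord_comparable[OF assms, of a c] by (simp add: el_def)
    then show "E a c"
      using mem_asym[of a b] mem_no_3_cycle[of a b c] ab bc by (auto simp: el_def)
  next
    fix a b
    assume "E a x" "E b x"
    then show "E a b \<or> a = b \<or> E b a" using ord_comparable[OF assms, of a b] by (simp add: el_def)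
  next
    fix s
    assume s: "subset_of E Ur s x" "\<exists>a. E a s"
    have "el s \<noteq> {}" using s(2) unfolding el_def by blast
    then obtain m where m: "m \<in> el s" "el m \<inter> el s = {}"
      by (rule foundation_coded[OF coded_el]) (rule that)
    have "a = m \<or> E m a" if a: "E a s" for a
    proof -
      have "a \<in> el x" "m \<in> el x" using s(1) a m(1) by (auto simp: subset_of_def el_def)
      then have "a \<in> el m \<or> a = m \<or> m \<in> el a" using ord_comparable[OF assms] by blast
      then show ?thesis using m(2) a by (auto simp: el_def)
    qed
    then show "\<exists>m. E m s \<and> (\<forall>a. E a s \<longrightarrow> a = m \<or> E m a)" using m(1) by (auto simp: el_def)
  qed
  then show ?thesis unfolding ordinal_def using t p by blast
qed

text \<open>A minimal element of \<open>y\<close> outside \<open>x\<close> has exactly the elements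
  of \<open>x\<close>, hence is \<open>x\<close>.\<close>

lemma ord_subset_mem:
  assumes "ord y" "\<not> Ur x" "transitive x" "el x \<subset> el y"
  shows "x \<in> el y"
proof -
  have "coded {z \<in> el y. z \<notin> el x}" by (intro coded_sep[OF coded_el] dfn_intros)
  moreover have "{z \<in> el y. z \<notin> el x} \<noteq> {}" using assms(4) by blast
  ultimately obtain m where m: "m \<in> {z \<in> el y. z \<notin> el x}" "el m \<inter> {z \<in> el y. z \<notin> el x} = {}"
    by (rule foundation_coded) (rule that)
  have "el m \<subseteq> el x"
  proof
    fix g assume g: "g \<in> el m"
    then have "g \<in> el y" using m(1) ord_transitive[OF assms(1)] by blast
    then show "g \<in> el x" using m(2) g by blast
  qed
  moreover have "el x \<subseteq> el m"
  proof
    fix g assume g: "g \<in> el x"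
    then have "g \<in> el m \<or> g = m \<or> m \<in> el g"
      using assms(4) m(1) ord_comparable[OF assms(1), of g m] by blast
    moreover have "m \<notin> el g" using transitiveD[OF assms(3) g] m(1) by blast
    ultimately show "g \<in> el m" using g m(1) by blast
  qed
  moreover have "\<not> Ur m" using m(1) assms(1) unfolding ord_def by blast
  ultimately have "m = x" using assms(2) by (intro el_ext) simp_all
  then show ?thesis using m(1) by simp
qed

text \<open>The intersection \<open>c\<close> is an initial segment of both ordinals. If it were
  proper in both, it would be an element of both and so of itself.\<close>

lemma ord_linear:
  assumes "ord x" "ord y"
  shows "x \<in> el y \<or> x = y \<or> y \<in> el x"
proof -
  define c where "c = mk {z \<in> el x. z \<in> el y}"
  have "coded {z \<in> el x. z \<in> el y}" by (intro coded_sep[OF coded_el] dfn_intros)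
  then have c: "\<not> Ur c" "el c = {z \<in> el x. z \<in> el y}" unfolding c_def by (simp_all add: not_Ur_mk el_mk)
  have t: "transitive c"
    unfolding transitive_def c(2) using ord_transitive assms by blast
  have x: "el c = el x \<or> c \<in> el x"
    using ord_subset_mem[OF assms(1) c(1) t] c(2) by blast
  have y: "el c = el y \<or> c \<in> el y"
    using ord_subset_mem[OF assms(2) c(1) t] c(2) by blast
  have ur: "\<not> Ur x" "\<not> Ur y" using assms unfolding ord_def by blast+
  have "c \<notin> el c" by (rule mem_irrefl)
  then have "el c = el x \<or> el c = el y" using x y c(2) by blast
  then have "c = x \<or> c = y" using el_ext[OF c(1)] ur by blast
  then show ?thesis using x y el_ext[OF c(1)] ur by metis
qed

lemma ord_zer: "ord zer"
  unfolding ord_def transitive_def el_zer using not_Ur_zer by simp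

lemma ord_sc: "ord n \<Longrightarrow> ord (sc n)"
  using not_Ur_sc[of n] unfolding ord_def transitive_def el_sc by blast

lemma ord_W:
  assumes "n \<in> W"
  shows "ord n"
  by (rule omega_induct[of ord, OF _ assms ord_zer ord_sc]) (intro dfn_intros)

lemma W_transitive:
  assumes "n \<in> W" "m \<in> el n"
  shows "m \<in> W"
proof -
  have "\<forall>m\<in>el n. m \<in> W"
  proof (rule omega_induct[of "\<lambda>n. \<forall>m\<in>el n. m \<in> W", OF _ assms(1)])
    show "dfnU (\<lambda>w. \<forall>m\<in>el (w 0). m \<in> W)" by (intro dfn_intros)
  qed (auto simp: el_zer el_sc)
  then show ?thesis using assms(2) by blast
qed

text \<open>Allows a bound on the exceptional indices to be raised past any further index.\<close>

lemma W_directed: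
  assumes "n \<in> W" "m \<in> W"
  obtains k where "k \<in> W" "el n \<subseteq> el k" "m \<in> el k"
proof -
  consider "m \<in> el n" | "m = n" | "n \<in> el m" using ord_linear[OF ord_W ord_W] assms by blast
  then show thesis
  proof cases
    case 1
    then show thesis using that[of n] assms by blast
  next
    case 2
    then show thesis using that[of "sc n"] assms by (simp add: sc_W el_sc subset_insertI)
  next
    case 3
    then have "el n \<subseteq> el m" using ord_transitive[OF ord_W[OF assms(2)]] by blast
    then show thesis using that[of "sc m"] assms by (simp add: sc_W el_sc subset_insertI2)
  qed
qed

section \<open>Hartogs numbers without Choice\<close>

definition rel :: "'u \<Rightarrow> 'u \<Rightarrow> ('u \<Rightarrow> 'u \<Rightarrow> bool) \<Rightarrow> 'u" where
  "rel X Y R = mk {p. \<exists>h\<in>el X. \<exists>a\<in>el Y. p = opair h a \<and> R h a}"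

text \<open>The product is the union of its slices over single elements of \<open>X\<close>, each of
  them a set by Replacement; Separation then cuts out the relation.\<close>

lemma opair_rel:
  assumes "dfnU (\<lambda>w. R (w 0) (w 1))"
  shows "opair h a \<in> el (rel X Y R) \<longleftrightarrow> h \<in> el X \<and> a \<in> el Y \<and> R h a"
proof -
  define F where "F h = mk {p. \<exists>a\<in>el Y. p = opair h a}" for h
  have F: "el (F h) = {p. \<exists>a\<in>el Y. p = opair h a}" for h
  proof -
    have "coded (opair h ` el Y)" by (intro coded_image[OF coded_el] dfn_intros)
    moreover have "opair h ` el Y = {p. \<exists>a\<in>el Y. p = opair h a}" by blast
    ultimately show ?thesis unfolding F_def using el_mk by simp
  qed
  have "dtermU (\<lambda>w. F (w 0))" unfolding F_def by (intro dfn_intros)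
  then have "coded (\<Union>y\<in>F ` el X. el y)" by (intro coded_Union coded_image[OF coded_el])
  moreover have "dfnU (\<lambda>w. \<exists>h\<in>el X. \<exists>a\<in>el Y. w 0 = opair h a \<and> R h a)"
    by (intro dfn_intros dfn_subst2[where R = R, OF assms])
  ultimately have "coded {p. \<exists>h\<in>el X. \<exists>a\<in>el Y. p = opair h a \<and> R h a}"
    by (rule coded_subset) (auto simp: F)
  then show ?thesis unfolding rel_def by (auto simp: el_mk opair_inject)
qed

text \<open>\<open>g\<close> need not be single-valued.\<close>

definition injective_rel :: "'u \<Rightarrow> 'u \<Rightarrow> 'u \<Rightarrow> bool" where
  "injective_rel g \<alpha> A \<longleftrightarrow> (\<forall>\<beta>\<in>el \<alpha>. \<exists>a\<in>el A. opair \<beta> a \<in> el g) \<and>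
    (\<forall>\<beta>\<in>el \<alpha>. \<forall>\<gamma>\<in>el \<alpha>. \<forall>a. opair \<beta> a \<in> el g \<longrightarrow> opair \<gamma> a \<in> el g \<longrightarrow> \<beta> = \<gamma>)"

definition injects :: "'u \<Rightarrow> 'u \<Rightarrow> bool" where
  "injects \<alpha> A \<longleftrightarrow> (\<exists>g. injective_rel g \<alpha> A)"

definition img :: "'u \<Rightarrow> 'u \<Rightarrow> 'u \<Rightarrow> 'u" where
  "img A g \<beta> = mk {a. a \<in> el A \<and> (\<exists>\<gamma>\<in>el \<beta>. opair \<gamma> a \<in> el g)}"

lemma dterm_img [dfn_intros]:
  assumes "dtermU t" "dtermU s"
  shows "dtermU (\<lambda>w. img A (t w) (s w))"
proof -
  have "dtermU (\<lambda>w. img A (w 0) (w 1))" unfolding img_def by (intro dfn_intros)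
  then show ?thesis by (rule dterm_subst2[where f = "img A", OF _ assms])
qed

lemma coded_img: "coded {a. a \<in> el A \<and> (\<exists>\<gamma>\<in>el \<beta>. opair \<gamma> a \<in> el g)}"
  by (intro coded_sep[OF coded_el] dfn_intros)

lemma el_img: "el (img A g \<beta>) = {a. a \<in> el A \<and> (\<exists>\<gamma>\<in>el \<beta>. opair \<gamma> a \<in> el g)}"
  unfolding img_def by (rule el_mk[OF coded_img])

lemma img_strict:
  assumes g: "injective_rel g \<alpha> A" and \<alpha>: "ord \<alpha>" and "\<beta> \<in> el \<alpha>" "\<gamma> \<in> el \<beta>"
  shows "el (img A g \<gamma>) \<subset> el (img A g \<beta>)"
proof -
  have \<gamma>: "\<gamma> \<in> el \<alpha>" using ord_transitive[OF \<alpha> assms(3,4)] .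
  have sub: "el \<gamma> \<subseteq> el \<beta>" using ord_transitive[OF ord_elem[OF \<alpha> assms(3)] assms(4)] by blast
  obtain a where a: "a \<in> el A" "opair \<gamma> a \<in> el g" using g \<gamma> unfolding injective_rel_def by blast
  have "a \<notin> el (img A g \<gamma>)"
  proof
    assume "a \<in> el (img A g \<gamma>)"
    then obtain \<delta> where \<delta>: "\<delta> \<in> el \<gamma>" "opair \<delta> a \<in> el g" unfolding el_img by blast
    then have "\<delta> \<in> el \<alpha>" using ord_transitive[OF \<alpha> \<gamma>] by blast
    then have "\<delta> = \<gamma>" using g \<gamma> a(2) \<delta>(2) unfolding injective_rel_def by blast
    then show False using \<delta>(1) mem_irrefl by blast
  qed
  moreover have "a \<in> el (img A g \<beta>)" unfolding el_img using a assms(4) by blast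
  moreover have "el (img A g \<gamma>) \<subseteq> el (img A g \<beta>)" unfolding el_img using sub by blast
  ultimately show ?thesis by blast
qed

lemma img_strict_iff:
  assumes g: "injective_rel g \<alpha> A" and \<alpha>: "ord \<alpha>" and "\<beta> \<in> el \<alpha>" "\<gamma> \<in> el \<alpha>"
  shows "el (img A g \<gamma>) \<subset> el (img A g \<beta>) \<longleftrightarrow> \<gamma> \<in> el \<beta>"
proof
  assume s: "el (img A g \<gamma>) \<subset> el (img A g \<beta>)"
  then have "\<not> el (img A g \<beta>) \<subset> el (img A g \<gamma>)" "\<beta> \<noteq> \<gamma>" by blast+
  then show "\<gamma> \<in> el \<beta>"
    using ord_comparable[OF \<alpha> assms(3,4)] img_strict[OF g \<alpha> assms(4)] by blast
qed (rule img_strict[OF g \<alpha> assms(3)])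

text \<open>The chain \<open>Q\<close> of initial images of an injection of \<open>\<alpha>\<close> into \<open>A\<close> determines \<open>\<alpha>\<close>; this is what
  makes the ordinals injecting into \<open>A\<close> form a set.\<close>

definition codes :: "'u \<Rightarrow> 'u \<Rightarrow> 'u \<Rightarrow> bool" where
  "codes A Q \<alpha> \<longleftrightarrow> ord \<alpha> \<and> (\<exists>g. injective_rel g \<alpha> A \<and>
    (\<forall>c. c \<in> el Q \<longleftrightarrow> (\<exists>\<beta>\<in>el \<alpha>. c = img A g \<beta>)))"

text \<open>Inclusion between initial images mirrors membership between their indices. By induction,
  indices with the same image under the two injections therefore have the same elements.\<close>

lemma codes_unique:
  assumes "codes A Q \<alpha>" "codes A Q \<alpha>'"
  shows "\<alpha> = \<alpha>'"
proof -
  obtain g where \<alpha>: "ord \<alpha>" and g: "injective_rel g \<alpha> A"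
    and Q: "\<forall>c. c \<in> el Q \<longleftrightarrow> (\<exists>\<beta>\<in>el \<alpha>. c = img A g \<beta>)"
    using assms(1) unfolding codes_def by (elim exE conjE)
  obtain g' where \<alpha>': "ord \<alpha>'" and g': "injective_rel g' \<alpha>' A"
    and Q': "\<forall>c. c \<in> el Q \<longleftrightarrow> (\<exists>\<beta>\<in>el \<alpha>'. c = img A g' \<beta>)"
    using assms(2) unfolding codes_def by (elim exE conjE)
  have to': "\<exists>x'\<in>el \<alpha>'. img A g x = img A g' x'" if "x \<in> el \<alpha>" for x using that Q Q' by blast
  have from': "\<exists>x\<in>el \<alpha>. img A g' x' = img A g x" if "x' \<in> el \<alpha>'" for x' using that Q Q' by blast
  let ?P = "\<lambda>\<beta>. \<beta> \<in> el \<alpha> \<longrightarrow> (\<forall>\<beta>'\<in>el \<alpha>'. img A g \<beta> = img A g' \<beta>' \<longrightarrow> \<beta> = \<beta>')"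
  have eq: "?P \<beta>" for \<beta>
  proof (rule mem_induct[of ?P])
    show "dfnU (\<lambda>w. w 0 \<in> el \<alpha> \<longrightarrow> (\<forall>\<beta>'\<in>el \<alpha>'. img A g (w 0) = img A g' \<beta>' \<longrightarrow> w 0 = \<beta>'))"
      by (intro dfn_intros)
    fix \<beta>
    assume IH: "\<And>x. x \<in> el \<beta> \<Longrightarrow> ?P x"
    show "?P \<beta>"
    proof (intro impI ballI)
      fix \<beta>'
      assume \<beta>: "\<beta> \<in> el \<alpha>" and \<beta>': "\<beta>' \<in> el \<alpha>'" and img: "img A g \<beta> = img A g' \<beta>'"
      have "el \<beta> = el \<beta>'"
      proof (intro equalityI subsetI)
        fix x assume x: "x \<in> el \<beta>"
        then have x\<alpha>: "x \<in> el \<alpha>" using ord_transitive[OF \<alpha> \<beta>] by blast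
        then obtain x' where x': "x' \<in> el \<alpha>'" "img A g x = img A g' x'" using to' by blast
        have "el (img A g' x') \<subset> el (img A g' \<beta>')"
          using img_strict[OF g \<alpha> \<beta> x] x'(2) img by simp
        then have "x' \<in> el \<beta>'" using img_strict_iff[OF g' \<alpha>' \<beta>' x'(1)] by simp
        then show "x \<in> el \<beta>'" using IH[OF x] x\<alpha> x' by blast
      next
        fix x' assume x': "x' \<in> el \<beta>'"
        then have x\<alpha>: "x' \<in> el \<alpha>'" using ord_transitive[OF \<alpha>' \<beta>'] by blast
        then obtain x where x: "x \<in> el \<alpha>" "img A g' x' = img A g x" using from' by blast
        have "el (img A g x) \<subset> el (img A g \<beta>)"
          using img_strict[OF g' \<alpha>' \<beta>' x'] x(2) img by simp
        then have "x \<in> el \<beta>" using img_strict_iff[OF g \<alpha> \<beta> x(1)] by simp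
        moreover from this have "x = x'" using IH[of x] x x\<alpha> by metis
        ultimately show "x' \<in> el \<beta>" by simp
      qed
      moreover have "\<not> Ur \<beta>" "\<not> Ur \<beta>'" using \<beta> \<beta>' \<alpha> \<alpha>' unfolding ord_def by blast+
      ultimately show "\<beta> = \<beta>'" by (intro el_ext)
    qed
  qed
  have "el \<alpha> = el \<alpha>'"
  proof (intro equalityI subsetI)
    fix x assume x: "x \<in> el \<alpha>"
    then obtain x' where "x' \<in> el \<alpha>'" "img A g x = img A g' x'" using to' by blast
    then show "x \<in> el \<alpha>'" using eq[of x] x by blast
  next
    fix x' assume x': "x' \<in> el \<alpha>'"
    then obtain x where "x \<in> el \<alpha>" "img A g' x' = img A g x" using from' by blast
    then show "x' \<in> el \<alpha>" using eq[of x] x' by metis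
  qed
  then show ?thesis using \<alpha> \<alpha>' unfolding ord_def by (intro el_ext) blast+
qed

text \<open>The chains live in the double power set of \<open>A\<close>, and Replacement sends each
  to the ordinal it codes, reaching every ordinal that injects into \<open>A\<close>. Stray values
  at objects that code nothing are removed by Separation.\<close>

lemma coded_injecting_ordinals: "coded {\<alpha>. ord \<alpha> \<and> injects \<alpha> A}"
proof -
  define P where "P = mk {z. \<not> Ur z \<and> el z \<subseteq> el A}"
  have P: "el P = {z. \<not> Ur z \<and> el z \<subseteq> el A}" unfolding P_def by (rule el_mk[OF coded_Pow])
  have "dtermU (\<lambda>w. the1 (codes A (w 0)))"
    unfolding codes_def injective_rel_def by (intro dfn_intros)
  then have "coded ((\<lambda>Q. the1 (codes A Q)) ` {z. \<not> Ur z \<and> el z \<subseteq> el P})"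
    by (rule coded_image[OF coded_Pow])
  moreover have "dfnU (\<lambda>w. ord (w 0) \<and> injects (w 0) A)"
    unfolding injects_def injective_rel_def by (intro dfn_intros)
  moreover have "\<alpha> \<in> (\<lambda>Q. the1 (codes A Q)) ` {z. \<not> Ur z \<and> el z \<subseteq> el P}"
    if \<alpha>: "ord \<alpha> \<and> injects \<alpha> A" for \<alpha>
  proof -
    obtain g where g: "injective_rel g \<alpha> A" using \<alpha> unfolding injects_def by blast
    have "coded (img A g ` el \<alpha>)" by (intro coded_image[OF coded_el] dfn_intros)
    note Q = not_Ur_mk[OF this] el_mk[OF this]
    have "codes A (mk (img A g ` el \<alpha>)) \<alpha>"
      unfolding codes_def using \<alpha> g by (intro conjI exI[of _ g]) (auto simp: Q)
    then have "the1 (codes A (mk (img A g ` el \<alpha>))) = \<alpha>"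
      using codes_unique by (intro the1_eq)
    moreover have "img A g \<beta> \<in> el P" for \<beta>
    proof -
      have "\<not> Ur (img A g \<beta>)" unfolding img_def by (rule not_Ur_mk[OF coded_img])
      then show ?thesis unfolding P by (auto simp: el_img)
    qed
    ultimately show ?thesis
      using Q by (intro image_eqI[of _ _ "mk (img A g ` el \<alpha>)"]) auto
  qed
  ultimately show ?thesis by (rule coded_subset)
qed

lemma is_bijection_iff:
  "is_bijection E Ur f x y \<Longrightarrow> a \<in> el x \<Longrightarrow> \<exists>!b. b \<in> el y \<and> opair a b \<in> el f"
  "is_bijection E Ur f x y \<Longrightarrow> b \<in> el y \<Longrightarrow> \<exists>!a. a \<in> el x \<and> opair a b \<in> el f"
  unfolding is_bijection_def is_opair_iff el_def by simp_all

text \<open>\<open>H\<close> is the Hartogs number of \<open>A\<close>. If it injected into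
  \<open>A\<close>, it would be an element of itself; if it were equinumerous with one of its
  elements, an injection of that element into \<open>A\<close> could be carried over to
  \<open>H\<close>.\<close>

lemma hartogs:
  obtains H where "ord H" "wo_cardinal E Ur H" "\<not> injects H A"
proof -
  define H where "H = mk {\<alpha>. ord \<alpha> \<and> injects \<alpha> A}"
  have H: "\<not> Ur H" "el H = {\<alpha>. ord \<alpha> \<and> injects \<alpha> A}"
    unfolding H_def using coded_injecting_ordinals by (simp_all add: not_Ur_mk el_mk)
  have "injects \<beta> A" if "ord \<alpha>" "injects \<alpha> A" "\<beta> \<in> el \<alpha>" for \<alpha> \<beta>
  proof -
    obtain g where g: "injective_rel g \<alpha> A" using \<open>injects \<alpha> A\<close> unfolding injects_def by blast
    have "el \<beta> \<subseteq> el \<alpha>" using ord_transitive[OF that(1,3)] by blast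
    then have "injective_rel g \<beta> A" using g unfolding injective_rel_def by blast
    then show ?thesis unfolding injects_def by blast
  qed
  then have t: "transitive H" unfolding transitive_def H(2) using ord_elem by blast
  have els: "ord y" if "y \<in> el H" for y using that H(2) by simp
  have ord: "ord H"
    unfolding ord_def[of H]
  proof (intro conjI ballI H(1) t)
    fix y assume "y \<in> el H"
    then show "\<not> Ur y" using els[of y] unfolding ord_def by simp
    fix z assume "z \<in> el H"
    then show "y \<in> el z \<or> y = z \<or> z \<in> el y" using \<open>y \<in> el H\<close> by (intro ord_linear els)
  qed
  have not: "\<not> injects H A" using mem_irrefl[of H] ord unfolding H(2) by blast
  have "\<not> equinumerous E Ur b H" if b: "E b H" for b
  proof
    assume "equinumerous E Ur b H"
    then obtain f where f: "is_bijection E Ur f b H" unfolding equinumerous_def by blast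
    have "injects b A" using b H(2) by (auto simp: el_def)
    then obtain g where g: "injective_rel g b A" unfolding injects_def by blast
    let ?R = "\<lambda>h a. \<exists>x\<in>el b. opair x h \<in> el f \<and> opair x a \<in> el g"
    have R: "opair h a \<in> el (rel H A ?R) \<longleftrightarrow> h \<in> el H \<and> a \<in> el A \<and> ?R h a" for h a
      by (intro opair_rel dfn_intros)
    have "injective_rel (rel H A ?R) H A"
      unfolding injective_rel_def R
    proof (intro conjI ballI allI impI)
      fix h assume h: "h \<in> el H"
      then obtain x where x: "x \<in> el b" "opair x h \<in> el f" using is_bijection_iff(2)[OF f h] by blast
      then obtain a where "a \<in> el A" "opair x a \<in> el g" using g unfolding injective_rel_def by blast
      then show "\<exists>a\<in>el A. h \<in> el H \<and> a \<in> el A \<and> ?R h a" using h x by blast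
    next
      fix h h' a
      assume h: "h \<in> el H" "h' \<in> el H" and "h \<in> el H \<and> a \<in> el A \<and> ?R h a" "h' \<in> el H \<and> a \<in> el A \<and> ?R h' a"
      then obtain x x' where x: "x \<in> el b" "opair x h \<in> el f" "opair x a \<in> el g"
        and x': "x' \<in> el b" "opair x' h' \<in> el f" "opair x' a \<in> el g" by blast
      have "x = x'" using g x x' unfolding injective_rel_def by blast
      then show "h = h'" using is_bijection_iff(1)[OF f x(1)] x x' h by blast
    qed
    then show False using not unfolding injects_def by blast
  qed
  then have "wo_cardinal E Ur H" unfolding wo_cardinal_def using ord_imp_ordinal[OF ord] by blast
  then show thesis using that ord not by blast
qed

end

section \<open>Sequences of urelements\<close>

context zfu
begin

definition least :: "('u \<Rightarrow> bool) \<Rightarrow> 'u" where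
  "least P = the1 (\<lambda>\<beta>. P \<beta> \<and> (\<forall>\<gamma>. P \<gamma> \<longrightarrow> \<gamma> = \<beta> \<or> \<beta> \<in> el \<gamma>))"

lemma dterm_least [dfn_intros]:
  assumes "dfnU (\<lambda>w. P (w 0) (\<lambda>n. w (Suc n)))"
  shows "dtermU (\<lambda>w. least (\<lambda>x. P x w))"
  unfolding least_def
  by (intro dfn_intros assms)
    (use dfn_rename[OF assms, of "case_nat 0 (\<lambda>n. Suc (Suc n))"] in simp)

lemma least:
  assumes "ord H" "dfnU (\<lambda>w. P (w 0))" "\<And>x. P x \<Longrightarrow> x \<in> el H" "P x"
  shows "P (least P)" "P y \<Longrightarrow> y = least P \<or> least P \<in> el y"
proof -
  have "coded {x. P x}" by (rule coded_subset[OF coded_el assms(2,3)])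
  moreover have "{x. P x} \<noteq> {}" using assms(4) by blast
  ultimately obtain m where m: "m \<in> {x. P x}" "el m \<inter> {x. P x} = {}"
    by (rule foundation_coded) (rule that)
  have m_least: "y = m \<or> m \<in> el y" if "P y" for y
    using ord_comparable[OF assms(1) assms(3) assms(3), of y m] m that by blast
  have "least P = m"
    unfolding least_def
  proof (rule the1_eq)
    show "P m \<and> (\<forall>\<gamma>. P \<gamma> \<longrightarrow> \<gamma> = m \<or> m \<in> el \<gamma>)" using m(1) m_least by blast
    fix \<beta>
    assume \<beta>: "P \<beta> \<and> (\<forall>\<gamma>. P \<gamma> \<longrightarrow> \<gamma> = \<beta> \<or> \<beta> \<in> el \<gamma>)"
    then have "m = \<beta> \<or> \<beta> \<in> el m" using m(1) by blast
    then show "\<beta> = m" using \<beta> m(2) by blast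
  qed
  then show "P (least P)" "P y \<Longrightarrow> y = least P \<or> least P \<in> el y" using m(1) m_least by blast+
qed

lemma W_not_Ur: "n \<in> W \<Longrightarrow> \<not> Ur n"
  using ord_W unfolding ord_def by blast

text \<open>Well-order a set of urelements that is too large to inject into the union of \<open>A\<close> and \<open>\<omega>\<close>, and list
  its elements outside \<open>A\<close> in increasing order. If this list stopped after finitely many steps, then
  sending the elements of the list to their positions and fixing the others would be an injection.\<close>

lemma urelement_sequence:
  assumes plen: "plenitude E Ur" and A: "\<forall>a\<in>el A. Ur a"
  obtains q where "dtermU (\<lambda>w. q (w 0))" "inj_on q W" "\<And>n. n \<in> W \<Longrightarrow> Ur (q n) \<and> q n \<notin> el A"
proof -
  define A' where "A' = mk (el A \<union> W)"
  have A': "el A' = el A \<union> W" unfolding A'_def by (rule el_mk[OF coded_Un[OF coded_el coded_el]])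
  obtain H where H: "ord H" "wo_cardinal E Ur H" "\<not> injects H A'" by (rule hartogs)
  obtain x f where x: "\<forall>a. E a x \<longrightarrow> Ur a" and f: "is_bijection E Ur f x H"
    using plen H(2) unfolding plenitude_def equinumerous_def by blast
  define r where "r \<alpha> = the1 (\<lambda>a. a \<in> el x \<and> opair a \<alpha> \<in> el f)" for \<alpha>
  have r: "r \<alpha> \<in> el x \<and> opair (r \<alpha>) \<alpha> \<in> el f" if "\<alpha> \<in> el H" for \<alpha>
    unfolding r_def by (rule the1I) (rule is_bijection_iff(2)[OF f that])
  have r_inj: "\<alpha> = \<beta>" if "\<alpha> \<in> el H" "\<beta> \<in> el H" "r \<alpha> = r \<beta>" for \<alpha> \<beta>
    using is_bijection_iff(1)[OF f, of "r \<alpha>"] r[OF that(1)] r[OF that(2)] that by metis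
  have r_Ur: "Ur (r \<alpha>)" if "\<alpha> \<in> el H" for \<alpha> using r[OF that] x by (simp add: el_def)
  have Dr: "dtermU (\<lambda>w. r (w 0))" unfolding r_def by (intro dfn_intros)
  define B where "B \<beta> \<longleftrightarrow> \<beta> \<in> el H \<and> r \<beta> \<notin> el A" for \<beta>
  have B_H: "\<beta> \<in> el H" if "B \<beta>" for \<beta> using that unfolding B_def by blast
  have DB: "dfnU (\<lambda>w. B (w i))" for i unfolding B_def by (intro dfn_intros dterm_subst1[OF Dr])
  \<comment> \<open>The default \<open>H\<close> marks the end of the list: it is not an element of
    itself and so fails \<open>B\<close>. Thus \<open>B (s n)\<close> says that the list is still
    running at \<open>n\<close>.\<close>
  define G where "G u = (if \<exists>\<beta>. B \<beta> \<and> u \<in> el \<beta> then least (\<lambda>\<beta>. B \<beta> \<and> u \<in> el \<beta>) else H)" for u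
  have "dtermU (\<lambda>w. G (w 0))" unfolding G_def by (intro dfn_intros DB)
  then obtain s where Ds: "dtermU (\<lambda>w. s (w 0))" and s0: "s zer = least B"
    and s_sc: "\<And>n. n \<in> W \<Longrightarrow> s (sc n) = G (s n)"
    by (rule omega_recursion[where ?x0.0 = "least B"]) (rule that)
  have G: "B (G u) \<and> u \<in> el (G u) \<and> (\<beta> = G u \<or> G u \<in> el \<beta>)" if "B \<beta>" "u \<in> el \<beta>" for u \<beta>
  proof -
    have D: "dfnU (\<lambda>w. B (w 0) \<and> u \<in> el (w 0))" by (intro dfn_intros DB)
    have G_eq: "G u = least (\<lambda>\<beta>. B \<beta> \<and> u \<in> el \<beta>)" unfolding G_def using that by auto
    show ?thesis
      unfolding G_eq using least[OF H(1) D, of \<beta>] B_H that by blast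
  qed
  have s_B: "B (s n)" if n: "n \<in> W" for n
  proof (rule ccontr)
    assume stop: "\<not> B (s n)"
    \<comment> \<open>An element of \<open>B\<close> that is never listed would stay above all
      listed ones, and then the list could not have stopped at \<open>n\<close>.\<close>
    have range: "\<exists>m\<in>W. s m = \<beta>" if \<beta>: "B \<beta>" for \<beta>
    proof (rule ccontr)
      assume no: "\<not> (\<exists>m\<in>W. s m = \<beta>)"
      have "B (s n) \<and> s n \<in> el \<beta>"
      proof (rule omega_induct[of "\<lambda>n. B (s n) \<and> s n \<in> el \<beta>", OF _ n])
        show "dfnU (\<lambda>w. B (s (w 0)) \<and> s (w 0) \<in> el \<beta>)"
          by (intro dfn_intros dfn_subst1[where R = B, OF DB] Ds)
        show "B (s zer) \<and> s zer \<in> el \<beta>"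
          unfolding s0 using least[OF H(1) DB B_H \<beta>] \<beta> no s0 zer_W by metis
        fix k assume k: "k \<in> W" "B (s k) \<and> s k \<in> el \<beta>"
        then show "B (s (sc k)) \<and> s (sc k) \<in> el \<beta>"
          using G[OF \<beta>, of "s k"] no sc_W[OF k(1)] unfolding s_sc[OF k(1), symmetric] by blast
      qed
      then show False using stop by blast
    qed
    \<comment> \<open>The two kinds of values cannot collide, since elements of \<open>A\<close> are
      urelements and natural numbers are sets.\<close>
    let ?R = "\<lambda>\<alpha> a. r \<alpha> \<in> el A \<and> a = r \<alpha> \<or> a \<in> W \<and> s a = \<alpha>"
    have R: "opair \<alpha> a \<in> el (rel H A' ?R) \<longleftrightarrow> \<alpha> \<in> el H \<and> a \<in> el A' \<and> ?R \<alpha> a" for \<alpha> a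
      by (intro opair_rel dfn_intros dterm_subst1[OF Dr] dterm_subst1[OF Ds])
    have "injective_rel (rel H A' ?R) H A'"
      unfolding injective_rel_def R
    proof (intro conjI ballI allI impI)
      fix \<alpha> assume \<alpha>: "\<alpha> \<in> el H"
      show "\<exists>a\<in>el A'. \<alpha> \<in> el H \<and> a \<in> el A' \<and> ?R \<alpha> a"
      proof (cases "r \<alpha> \<in> el A")
        case True
        then show ?thesis using \<alpha> unfolding A' by blast
      next
        case False
        then obtain m where "m \<in> W" "s m = \<alpha>" using range[of \<alpha>] \<alpha> unfolding B_def by blast
        then show ?thesis using \<alpha> unfolding A' by blast
      qed
    next
      fix \<alpha> \<beta> a
      assume "\<alpha> \<in> el H" "\<beta> \<in> el H" "\<alpha> \<in> el H \<and> a \<in> el A' \<and> ?R \<alpha> a" "\<beta> \<in> el H \<and> a \<in> el A' \<and> ?R \<beta> a"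
      then show "\<alpha> = \<beta>" using r_inj[of \<alpha> \<beta>] W_not_Ur[of a] A by metis
    qed
    then show False using H(3) unfolding injects_def by blast
  qed
  have mono: "\<forall>m\<in>el n. s m \<in> el (s n)" if n: "n \<in> W" for n
  proof (rule omega_induct[of "\<lambda>n. \<forall>m\<in>el n. s m \<in> el (s n)", OF _ n])
    show "dfnU (\<lambda>w. \<forall>m\<in>el (w 0). s m \<in> el (s (w 0)))"
      by (intro dfn_intros dterm_subst1[OF Ds])
    show "\<forall>m\<in>el zer. s m \<in> el (s zer)" by (simp add: el_zer)
    fix k assume k: "k \<in> W" "\<forall>m\<in>el k. s m \<in> el (s k)"
    have B: "B (G (s k))" using s_B[OF sc_W[OF k(1)]] s_sc[OF k(1)] by simp
    have "\<exists>\<beta>. B \<beta> \<and> s k \<in> el \<beta>"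
    proof (rule ccontr)
      assume "\<not> ?thesis"
      then have "G (s k) = H" unfolding G_def by (rule if_not_P)
      then show False using B B_H mem_irrefl[of H] by simp
    qed
    then have sk: "s k \<in> el (s (sc k))" using G unfolding s_sc[OF k(1)] by blast
    moreover have "s m \<in> el (s (sc k))" if m: "m \<in> el k" for m
      using ord_transitive[OF ord_elem[OF H(1) B_H[OF s_B[OF sc_W[OF k(1)]]]] sk] k(2) m by blast
    ultimately show "\<forall>m\<in>el (sc k). s m \<in> el (s (sc k))" unfolding el_sc by blast
  qed
  show thesis
  proof (rule that[of "\<lambda>n. r (s n)"])
    show "dtermU (\<lambda>w. r (s (w 0)))" by (intro dterm_subst1[OF Dr] Ds)
    show "inj_on (\<lambda>n. r (s n)) W"
    proof (rule inj_onI)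
      fix m n
      assume m: "m \<in> W" and n: "n \<in> W" and rs: "r (s m) = r (s n)"
      have eq: "s m = s n" by (rule r_inj[OF B_H[OF s_B[OF m]] B_H[OF s_B[OF n]] rs])
      have "m \<notin> el n" using bspec[OF mono[OF n], of m] mem_irrefl[of "s n"] unfolding eq by (intro notI) simp
      moreover have "n \<notin> el m" using bspec[OF mono[OF m], of n] mem_irrefl[of "s n"] unfolding eq by (intro notI) simp
      ultimately show "m = n" using ord_linear[OF ord_W[OF m] ord_W[OF n]] by blast
    qed
    fix n assume "n \<in> W"
    from s_B[OF this] show "Ur (r (s n)) \<and> r (s n) \<notin> el A" using r_Ur unfolding B_def by blast
  qed
qed

text \<open>Sets are determined by their elements, so being fixed climbs from the urelements through
  the whole transitive closure.\<close>

lemma fixes_tc: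
  assumes s: "involutive_automorphism E Ur s" "dtermU (\<lambda>w. s (w 0))"
    and fixed: "\<And>a. Ur a \<Longrightarrow> a \<in> el (tc x) \<Longrightarrow> s a = a"
  shows "s x = x"
proof -
  interpret involutive_automorphism E Ur s by (rule s(1))
  have "y \<in> el (tc x) \<longrightarrow> s y = y" for y
  proof (rule mem_induct[of "\<lambda>y. y \<in> el (tc x) \<longrightarrow> s y = y"])
    show "dfnU (\<lambda>w. w 0 \<in> el (tc x) \<longrightarrow> s (w 0) = w 0)" by (intro dfn_intros s(2))
    fix y
    assume IH: "\<And>z. z \<in> el y \<Longrightarrow> z \<in> el (tc x) \<longrightarrow> s z = z"
    show "y \<in> el (tc x) \<longrightarrow> s y = y"
    proof
      assume y: "y \<in> el (tc x)"
      show "s y = y"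
      proof (cases "Ur y")
        case True
        then show ?thesis using fixed y by blast
      next
        case False
        have "s z = z" if "z \<in> el y" for z using IH[OF that] transitiveD[OF transitive_tc y that] by blast
        then have "el (s y) = el y" unfolding el_automorphism[OF s(1)] by simp
        then show ?thesis using False Ur_iff by (intro el_ext) simp_all
      qed
    qed
  qed
  then show ?thesis using self_tc by blast
qed

text \<open>An automorphism fixing \<open>x\<close> may move urelements below \<open>x\<close>, but
  only among themselves. It cannot exchange one of them for a urelement from outside the
  closure.\<close>

lemma image_tc:
  assumes s: "involutive_automorphism E Ur s" and fixed: "s x = x"
  shows "s ` el (tc x) = el (tc x)"
proof -
  interpret involutive_automorphism E Ur s by (rule s)
  note el_s = el_automorphism[OF s]
  have "transitive (s (tc x))"
    unfolding transitive_def
  proof (intro ballI)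
    fix y z
    assume "y \<in> el (s (tc x))" and z: "z \<in> el y"
    then obtain u where u: "u \<in> el (tc x)" "y = s u" unfolding el_s by blast
    then obtain v where "v \<in> el u" "z = s v" using z el_s by blast
    then show "z \<in> el (s (tc x))" unfolding el_s using transitiveD[OF transitive_tc u(1)] by blast
  qed
  moreover have "x \<in> el (s (tc x))"
    unfolding el_s mem_image_iff fixed by (rule self_tc)
  ultimately have "el (tc x) \<subseteq> s ` el (tc x)" using tc_least el_s by blast
  then show ?thesis using mem_image_iff involution by blast
qed

text \<open>A definable class has a single parameter, so a sequence is packaged as the chain
  \<open>C\<close> of its initial pieces. The union of the chain is the range of the sequence, and
  exceptions confined to one member of the chain are finitely many in the sense of the
  model.\<close>

definition almost_covers :: "'u \<Rightarrow> 'u set" where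
  "almost_covers C = {y. \<exists>c\<in>el C. (\<Union>d\<in>el C. el d) \<subseteq> el y \<union> el c}"

lemma definable_almost_covers: "definable_class E Ur (almost_covers C)"
proof -
  \<comment> \<open>Variable 0 is \<open>y\<close> and variable 1 the parameter \<open>C\<close>; 2
    stands for \<open>c\<close>, 3 for a possible uncovered element, and 4 for a member of
    \<open>C\<close> containing it.\<close>
  define \<psi> where "\<psi> = Neg (All 2 (Neg (Conj (Mem 2 1) (All 3 (Neg (Conj
    (Neg (All 4 (Neg (Conj (Mem 4 1) (Mem 3 4))))) (Conj (Neg (Mem 3 0)) (Neg (Mem 3 2)))))))))"
  have "almost_covers C = {x. sat E Ur ((\<lambda>_. C)(0 := x)) \<psi>}"
    unfolding almost_covers_def \<psi>_def el_def by (simp add: subset_iff) blast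
  then show ?thesis unfolding definable_class_def by blast
qed

lemma almost_covers_image:
  assumes s: "involutive_automorphism E Ur s"
  shows "s ` almost_covers C = almost_covers (s C)"
proof -
  interpret involutive_automorphism E Ur s by (rule s)
  note el_s = el_automorphism[OF s]
  have sub: "s ` almost_covers C \<subseteq> almost_covers (s C)" for C
  proof
    fix y assume "y \<in> s ` almost_covers C"
    then obtain z c where z: "y = s z" "c \<in> el C" "(\<Union>d\<in>el C. el d) \<subseteq> el z \<union> el c"
      unfolding almost_covers_def by blast
    have "s ` (\<Union>d\<in>el C. el d) \<subseteq> s ` (el z \<union> el c)" using z(3) by (rule image_mono)
    then have "(\<Union>d\<in>el (s C). el d) \<subseteq> el y \<union> el (s c)"
      unfolding el_s z(1) by (simp add: image_Un image_UN el_s)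
    then show "y \<in> almost_covers (s C)" unfolding almost_covers_def using z(2) el_s[of C] by blast
  qed
  have "s ` almost_covers (s C) \<subseteq> almost_covers C" using sub[of "s C"] unfolding involution .
  then have "almost_covers (s C) \<subseteq> s ` almost_covers C" using mem_image_iff by blast
  then show ?thesis using sub by blast
qed

end

section \<open>The contradiction\<close>

context zfu
begin

lemma no_extension_map:
  assumes plen: "plenitude E Ur" and "param_definable_map E Ur ext" and "basic_law_V E Ur ext"
  shows False
proof -
  obtain \<phi> P where P: "definable_class E Ur P"
    and map: "\<And>X y. definable_class E Ur X \<Longrightarrow>
      ext X = y \<longleftrightarrow> sat2 E Ur (\<lambda>_. y) ((\<lambda>_. P)(0 := X)) \<phi>"
    using assms(2) unfolding param_definable_map_def by blast
  obtain \<psi> z where P_eq: "P = {x. sat E Ur ((\<lambda>_. z)(0 := x)) \<psi>}"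
    using P unfolding definable_class_def by (elim exE)
  define A where "A = mk {a \<in> el (tc z). Ur a}"
  have A: "el A = {a \<in> el (tc z). Ur a}"
    unfolding A_def by (intro el_mk coded_sep coded_el dfn_intros)
  have equivariant: "ext (s ` X) = s (ext X)"
    if s: "involutive_automorphism E Ur s" "dtermU (\<lambda>w. s (w 0))"
      and sA: "\<And>a. a \<in> el A \<Longrightarrow> s a = a" and X: "definable_class E Ur X" for s X
  proof -
    interpret involutive_automorphism E Ur s by (rule s(1))
    have "s z = z" by (rule fixes_tc[OF s]) (simp add: sA A)
    then have sP: "s ` P = P" unfolding P_eq image_Collect_sat by simp
    show ?thesis by (rule definable_map_equivariant[OF map sP X])
  qed

  obtain p where Dp: "dtermU (\<lambda>w. p (w 0))" and p_inj: "inj_on p W"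
    and p: "\<And>n. n \<in> W \<Longrightarrow> Ur (p n) \<and> p n \<notin> el A"
    by (rule urelement_sequence[OF plen, of A]) (simp add: A, rule that)
  define A\<^sub>2 where "A\<^sub>2 = mk (el A \<union> p ` W)"
  have A\<^sub>2: "el A\<^sub>2 = el A \<union> p ` W"
    unfolding A\<^sub>2_def by (intro el_mk coded_Un coded_image coded_el Dp)
  have A\<^sub>2_Ur: "\<forall>a\<in>el A\<^sub>2. Ur a" using p unfolding A\<^sub>2 A by blast
  \<comment> \<open>Avoiding \<open>A\<^sub>2\<close>, which includes the range of \<open>p\<close>,
    makes the two sequences disjoint.\<close>
  obtain q where Dq: "dtermU (\<lambda>w. q (w 0))" and q_inj: "inj_on q W"
    and q: "\<And>n. n \<in> W \<Longrightarrow> Ur (q n) \<and> q n \<notin> el A\<^sub>2"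
    by (rule urelement_sequence[OF plen A\<^sub>2_Ur]) (rule that)
  have pq: "p m \<noteq> q n" if "m \<in> W" "n \<in> W" for m n
  proof
    assume eq: "p m = q n"
    have "p m \<in> el A\<^sub>2" unfolding A\<^sub>2 using that by blast
    then show False unfolding eq using q[OF that(2)] by blast
  qed

  define c where "c n = mk {x. \<exists>m\<in>el n. x = p m}" for n
  have c: "el (c n) = p ` el n" for n
  proof -
    have eq: "{x. \<exists>m\<in>el n. x = p m} = p ` el n" by blast
    show ?thesis unfolding c_def eq by (intro el_mk coded_image coded_el Dp)
  qed
  have Dc: "dtermU (\<lambda>w. c (w 0))" unfolding c_def by (intro dfn_intros dterm_subst1[OF Dp])
  define C where "C = mk (c ` W)"
  have C: "el C = c ` W" unfolding C_def by (intro el_mk coded_image coded_el Dc)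
  have Union_C: "(\<Union>d\<in>el C. el d) = p ` W"
  proof -
    have "(\<Union>n\<in>W. el n) = W"
    proof (intro equalityI subsetI)
      fix m assume "m \<in> (\<Union>n\<in>W. el n)"
      then show "m \<in> W" by (elim UN_E) (rule W_transitive)
    next
      fix m assume "m \<in> W"
      then show "m \<in> (\<Union>n\<in>W. el n)" by (intro UN_I[of "sc m"] sc_W) (simp_all add: el_sc)
    qed
    then show ?thesis unfolding C by (simp add: c image_UN[symmetric])
  qed
  define X where "X = almost_covers C"
  have X: "definable_class E Ur X" unfolding X_def by (rule definable_almost_covers)
  have X_iff: "y \<in> X \<longleftrightarrow> (\<exists>n\<in>W. p ` W \<subseteq> el y \<union> p ` el n)" for y
    unfolding X_def almost_covers_def Union_C by (simp add: C c)
  have sX_iff: "y \<in> s ` X \<longleftrightarrow> (\<exists>n\<in>W. s ` p ` W \<subseteq> el y \<union> s ` p ` el n)"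
    if s: "involutive_automorphism E Ur s" for s y
  proof -
    have eq: "(\<Union>d\<in>el (s C). el d) = s ` p ` W"
      unfolding el_automorphism[OF s] Union_C[symmetric] by (simp add: el_automorphism[OF s] image_UN)
    show ?thesis
      unfolding X_def almost_covers_image[OF s] unfolding almost_covers_def mem_Collect_eq eq
      by (simp add: el_automorphism[OF s] C c)
  qed

  define e where "e = ext X"
  have kernel: "a \<in> el A" if a: "Ur a" "a \<in> el (tc e)" for a
  proof (rule ccontr)
    assume aA: "a \<notin> el A"
    define A\<^sub>3 where "A\<^sub>3 = mk (el A \<union> {u \<in> el (tc e). Ur u})"
    have A\<^sub>3: "el A\<^sub>3 = el A \<union> {u \<in> el (tc e). Ur u}"
      unfolding A\<^sub>3_def by (intro el_mk coded_Un coded_sep coded_el dfn_intros)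
    have A\<^sub>3_Ur: "\<forall>u\<in>el A\<^sub>3. Ur u" unfolding A\<^sub>3 A by blast
    \<comment> \<open>Avoiding \<open>A\<^sub>3\<close> provides a partner \<open>b\<close> for
      \<open>a\<close> outside both \<open>A\<close> and the closure of \<open>e\<close>; the first
      term of the sequence is enough.\<close>
    obtain r where "\<And>n. n \<in> W \<Longrightarrow> Ur (r n) \<and> r n \<notin> el A\<^sub>3"
      by (rule urelement_sequence[OF plen A\<^sub>3_Ur]) (rule that)
    then obtain b where b: "Ur b" "b \<notin> el A" "b \<notin> el (tc e)"
      using zer_W unfolding A\<^sub>3 by blast
    define F where "F x = (if x = a then b else if x = b then a else x)" for x
    have DF: "dtermU (\<lambda>w. F (w 0))" unfolding F_def by (intro dfn_intros)
    have F_Ur: "\<forall>x. Ur x \<longrightarrow> Ur (F x)" using a b by (simp add: F_def)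
    have F_inv: "\<forall>x. Ur x \<longrightarrow> F (F x) = x" by (simp add: F_def)
    obtain t where t: "involutive_automorphism E Ur t" "dtermU (\<lambda>w. t (w 0))"
      and t_Ur: "\<And>u. Ur u \<Longrightarrow> t u = F u"
      by (rule extend_involution[OF DF F_Ur F_inv]) (rule that)
    interpret involutive_automorphism E Ur t by (rule t(1))
    have tA: "t u = u" if "u \<in> el A" for u
    proof -
      have "Ur u" "u \<noteq> a" "u \<noteq> b" using that aA b unfolding A by blast+
      then show ?thesis by (simp add: t_Ur F_def)
    qed
    have "y \<in> t ` X" if "y \<in> X" for y
    proof -
      from that obtain n where n: "n \<in> W" "p ` W \<subseteq> el y \<union> p ` el n"
        unfolding X_iff by (elim bexE)
      \<comment> \<open>\<open>t\<close> moves no urelement except \<open>a\<close> and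
        \<open>b\<close>. Raising the bound past the indices that these may have in \<open>p\<close>
        places them among the exceptions.\<close>
      have above: "\<exists>k\<in>W. el m \<subseteq> el k \<and> (u \<in> p ` W \<longrightarrow> u \<in> p ` el k)" if m: "m \<in> W" for m u
      proof (cases "u \<in> p ` W")
        case True
        then obtain i where i: "i \<in> W" "u = p i" by blast
        obtain k where "k \<in> W" "el m \<subseteq> el k" "i \<in> el k" by (rule W_directed[OF m i(1)])
        then show ?thesis using i(2) by blast
      next
        case False
        then show ?thesis using m by blast
      qed
      obtain k where k: "k \<in> W" "el n \<subseteq> el k" "a \<in> p ` W \<longrightarrow> a \<in> p ` el k"
        using above[OF n(1), of a] by blast
      obtain l where l: "l \<in> W" "el k \<subseteq> el l" "b \<in> p ` W \<longrightarrow> b \<in> p ` el l"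
        using above[OF k(1), of b] by blast
      have "t u \<in> el y \<union> t ` p ` el l" if u: "u \<in> p ` W" for u
      proof (cases "u \<in> p ` el l")
        case True
        then show ?thesis by blast
      next
        case False
        have "Ur u" using u p by blast
        moreover have "u \<noteq> a" "u \<noteq> b" using False u k(3) l by blast+
        ultimately have "t u = u" by (simp add: t_Ur F_def)
        moreover have "u \<in> el y" using False u n(2) k(2) l(2) by blast
        ultimately show ?thesis by simp
      qed
      then show ?thesis unfolding sX_iff[OF t(1)] using l(1) by blast
    qed
    then have "t ` X = X" using mem_image_iff involution by blast
    then have "t e = e" using equivariant[OF t tA X] unfolding e_def by simp
    then have "t ` el (tc e) = el (tc e)" by (rule image_tc[OF t(1)])
    \<comment> \<open>This is absurd because \<open>t a\<close> is \<open>b\<close>, chosen outside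
      the closure of \<open>e\<close>.\<close>
    then have "t a \<in> el (tc e)" using a(2) by blast
    then show False using b(3) by (simp add: t_Ur a F_def)
  qed

  \<comment> \<open>Exchanges \<open>p n\<close> with \<open>q n\<close>. Recovering the index by
    \<open>the1\<close> keeps the exchange definable, and injectivity makes the index
    unique.\<close>
  define F where "F x = (if \<exists>n\<in>W. x = p n then q (the1 (\<lambda>n. n \<in> W \<and> x = p n))
    else if \<exists>n\<in>W. x = q n then p (the1 (\<lambda>n. n \<in> W \<and> x = q n)) else x)" for x
  have DF: "dtermU (\<lambda>w. F (w 0))"
    unfolding F_def by (intro dfn_intros dterm_subst1[OF Dp] dterm_subst1[OF Dq])
  have Fp: "F (p n) = q n" if n: "n \<in> W" for n
  proof -
    have "the1 (\<lambda>m. m \<in> W \<and> p n = p m) = n"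
      by (rule the1_eq) (use n p_inj in \<open>auto dest: inj_onD\<close>)
    then show ?thesis unfolding F_def using n by auto
  qed
  have Fq: "F (q n) = p n" if n: "n \<in> W" for n
  proof -
    have "the1 (\<lambda>m. m \<in> W \<and> q n = q m) = n"
      by (rule the1_eq) (use n q_inj in \<open>auto dest: inj_onD\<close>)
    moreover have "\<not> (\<exists>m\<in>W. q n = p m)" using pq n by metis
    ultimately show ?thesis unfolding F_def using n by auto
  qed
  have F_id: "F x = x" if "x \<notin> p ` W" "x \<notin> q ` W" for x
    unfolding F_def using that by auto
  have F_cases: "(\<exists>n\<in>W. x = p n) \<or> (\<exists>n\<in>W. x = q n) \<or> F x = x" for x
    using F_id by blast
  have F_Ur: "\<forall>x. Ur x \<longrightarrow> Ur (F x)"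
  proof (intro allI impI)
    fix x assume "Ur x"
    then show "Ur (F x)" using F_cases[of x] p q by (elim disjE bexE) (simp_all add: Fp Fq)
  qed
  have F_inv: "\<forall>x. Ur x \<longrightarrow> F (F x) = x"
  proof (intro allI impI)
    fix x
    show "F (F x) = x" using F_cases[of x] by (elim disjE bexE) (simp_all add: Fp Fq)
  qed
  obtain s where s: "involutive_automorphism E Ur s" "dtermU (\<lambda>w. s (w 0))"
    and s_Ur: "\<And>u. Ur u \<Longrightarrow> s u = F u"
    by (rule extend_involution[OF DF F_Ur F_inv]) (rule that)
  have sA: "s a = a" if "a \<in> el A" for a
  proof -
    have "a \<notin> p ` W" "a \<notin> q ` W" using that p q unfolding A\<^sub>2 by blast+
    moreover have "Ur a" using that unfolding A by blast
    ultimately show ?thesis using F_id s_Ur by simp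
  qed
  have "s e = e" by (rule fixes_tc[OF s]) (simp add: kernel sA)
  then have "ext (s ` X) = ext X" using equivariant[OF s sA X] unfolding e_def by simp
  then have sX: "s ` X = X"
    using assms(3) X involutive_automorphism.image_definable[OF s(1) X]
    unfolding basic_law_V_def by blast
  \<comment> \<open>The range of \<open>q\<close> separates the two classes: it lies in the image of
    \<open>X\<close> without exceptions, so that \<open>zer\<close> serves as the bound, but it
    contains no term of \<open>p\<close>.\<close>
  define y where "y = mk (q ` W)"
  have y: "el y = q ` W" unfolding y_def by (intro el_mk coded_image coded_el Dq)
  have "s ` p ` W = q ` W" unfolding image_image by (intro image_cong refl) (simp add: s_Ur p Fp)
  then have "y \<in> s ` X" unfolding sX_iff[OF s(1)] y using zer_W by blast
  then obtain n where n: "n \<in> W" "p ` W \<subseteq> q ` W \<union> p ` el n" unfolding sX X_iff y by blast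
  \<comment> \<open>The term with index \<open>n\<close> defeats the bound \<open>n\<close>: being
    missed by \<open>q\<close>, it would have to equal a term of smaller index, against
    injectivity.\<close>
  have "p n \<notin> q ` W" using pq[OF n(1)] by auto
  then have "p n \<in> p ` el n" using n by blast
  then obtain m where m: "m \<in> el n" "p n = p m" by blast
  then have "n = m" using p_inj n(1) W_transitive[OF n(1) m(1)] by (auto dest: inj_onD)
  then show False using m(1) mem_irrefl by blast
qed

end

theorem theorem5:
  fixes E :: "'u \<Rightarrow> 'u \<Rightarrow> bool" and Ur :: "'u \<Rightarrow> bool"
  assumes "ZFU_R E Ur" and "plenitude E Ur"
  shows "\<not> (\<exists>ext. param_definable_map E Ur ext \<and> basic_law_V E Ur ext)"
  using zfu.no_extension_map[OF zfu.intro[OF assms(1)] assms(2)] by blast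

end
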